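(* Let $G:[-1,1]\to\mathbb{R}$ be continuous and non-decreasing with $G(0)=0$, and let $\beta\in\mathbb{R}$. (a) Let $N\ge 1$, let $B^1,\ldots,B^N$ be independent standard Brownian motions and let $Z^{N,1},\ldots,Z^{N,N}$ be i.i.d. real random variables independent of $(B^1,\ldots,B^N)$. Then the particle system $$X^{N,i}_t=Z^{N,i}+\beta t+B^i_t-G(L^N_t),\qquad L^N_t=\frac1N\sum_{i=1}^N\mathds 1_{\{\tau^N_i\le t\}},\qquad \tau^N_i=\inf\{t\ge 0: X^{N,i}_t\le 0\},\quad t\ge0,\ i=1,\dots,N,$$ has a unique minimal solution. (b) Let $Z$ be a real random variable and $B$ an independent standard Brownian motion. Then the McKean–Vlasov equation $$X_t=Z+\beta t+B_t-G(\Lambda_t),\qquad \Lambda_t=\mathbb{P}(\tau\le t),\qquad \tau=\inf\{t\ge0:X_t\le0\},\quad t\ge 0,$$ has a unique minimal solution $(\underline X,\underline\Lambda)$. Moreover, if $\beta>0$, then $\underline\Lambda_\infty<\Lambda_\infty$ for every solution $(X,\Lambda)$ of this McKean–Vlasov equation that is different from the minimal solution.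
   Context: $\mathcal D$ denotes the space of càdlàg functions on $[-1,\infty)$, and $\mathbb M$ is the set of non-decreasing $\ell\in\mathcal D$ with $\ell_t=0$ for all $t\in[-1,0)$ and $\ell_\infty:=\lim_{t\to\infty}\ell_t\le1$. Let $\mathbb F=(\mathcal F_t)_{t\ge0}$ with $\mathcal F_t=\sigma(Z^{N,i},B^i_s:\ 1\le i\le N,\ s\in[0,t])$. A solution of the particle system is a tuple $(X^{N,1},\dots,X^{N,N},L^N)$ where $L^N$ is an $\mathbb F$-adapted process with values in $\mathbb M$ and the displayed equations hold with probability one. It is minimal if $\underline L^N_t\le L^N_t$ for all $t\ge0$ (a.s.) for every solution $(X^{N,1},\dots,X^{N,N},L^N)$. A solution of the McKean–Vlasov equation is a pair $(X,\Lambda)$ with $\Lambda\in\mathbb M$ deterministic such that the displayed equations hold; it is minimal if $\underline\Lambda_t\le\Lambda_t$ for all $t\ge0$ and every solution $(X,\Lambda)$. $\Lambda_\infty=\lim_{t\to\infty}\Lambda_t$. *)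

theory Defs
  imports "HOL-Probability.Probability"
begin

(* Skorokhod space D on [-1,oo): cadlag functions, represented as real => real
   (values outside [-1,oo) are irrelevant). *)
definition cadlag :: "(real \<Rightarrow> real) \<Rightarrow> bool" where
  "cadlag l \<longleftrightarrow> (\<forall>t\<ge>-1. (l \<longlongrightarrow> l t) (at_right t)) \<and>
                  (\<forall>t>-1. \<exists>c. (l \<longlongrightarrow> c) (at_left t))"

definition MM :: "(real \<Rightarrow> real) set" where
  "MM = {l. cadlag l \<and> mono_on {-1..} l \<and> (\<forall>t\<in>{-1..<0}. l t = 0) \<and>
            (\<exists>c. (l \<longlongrightarrow> c) at_top \<and> c \<le> 1)}"

(* first hitting time of (-oo,0] on [0,oo); Inf {} = oo *)
definition hitting_time :: "(real \<Rightarrow> real) \<Rightarrow> ereal" where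
  "hitting_time x = Inf {ereal s | s. 0 \<le> s \<and> x s \<le> 0}"

definition std_BM :: "'a measure \<Rightarrow> (real \<Rightarrow> 'a \<Rightarrow> real) \<Rightarrow> bool" where
  "std_BM M B \<longleftrightarrow>
     (\<forall>t\<ge>0. B t \<in> borel_measurable M) \<and>
     (\<forall>\<omega>\<in>space M. B 0 \<omega> = 0 \<and> continuous_on {0..} (\<lambda>t. B t \<omega>)) \<and>
     (\<forall>s t. 0 \<le> s \<and> s < t \<longrightarrow>
        distributed M lborel (\<lambda>\<omega>. B t \<omega> - B s \<omega>)
          (\<lambda>x. ennreal (normal_density 0 (sqrt (t - s)) x))) \<and>
     (\<forall>(ts::nat \<Rightarrow> real) n. 0 \<le> ts 0 \<and> (\<forall>k<n. ts k < ts (Suc k)) \<longrightarrow>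
        prob_space.indep_vars M (\<lambda>_. borel) (\<lambda>k \<omega>. B (ts (Suc k)) \<omega> - B (ts k) \<omega>) {..<n})"

definition path :: "(real \<Rightarrow> 'a \<Rightarrow> real) \<Rightarrow> 'a \<Rightarrow> (real \<Rightarrow> real)" where
  "path B \<omega> = (\<lambda>t\<in>{0..}. B t \<omega>)"

definition path_space :: "(real \<Rightarrow> real) measure" where
  "path_space = PiM {0..} (\<lambda>_. borel)"

definition particle_setting ::
  "'a measure \<Rightarrow> nat \<Rightarrow> (nat \<Rightarrow> 'a \<Rightarrow> real) \<Rightarrow> (nat \<Rightarrow> real \<Rightarrow> 'a \<Rightarrow> real) \<Rightarrow> bool" where
  "particle_setting M N Z B \<longleftrightarrow>
     prob_space M \<and> 1 \<le> N \<and>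
     (\<forall>i\<in>{1..N}. std_BM M (B i)) \<and>
     prob_space.indep_vars M (\<lambda>_. path_space) (\<lambda>i. path (B i)) {1..N} \<and>
     (\<forall>i\<in>{1..N}. Z i \<in> borel_measurable M) \<and>
     prob_space.indep_vars M (\<lambda>_. borel) Z {1..N} \<and>
     (\<forall>i\<in>{1..N}. distr M borel (Z i) = distr M borel (Z 1)) \<and>
     prob_space.indep_set M
        (sets (vimage_algebra (space M) (\<lambda>\<omega>. \<lambda>i\<in>{1..N}. Z i \<omega>) (PiM {1..N} (\<lambda>_. borel))))
        (sets (vimage_algebra (space M) (\<lambda>\<omega>. \<lambda>i\<in>{1..N}. path (B i) \<omega>) (PiM {1..N} (\<lambda>_. path_space))))"

definition particle_filtration ::
  "'a measure \<Rightarrow> nat \<Rightarrow> (nat \<Rightarrow> 'a \<Rightarrow> real) \<Rightarrow> (nat \<Rightarrow> real \<Rightarrow> 'a \<Rightarrow> real) \<Rightarrow> real \<Rightarrow> 'a measure" where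
  "particle_filtration M N Z B t = sigma (space M)
     ((\<Union>i\<in>{1..N}. {Z i -` A \<inter> space M | A. A \<in> sets borel}) \<union>
      (\<Union>i\<in>{1..N}. \<Union>s\<in>{0..t}. {B i s -` A \<inter> space M | A. A \<in> sets borel}))"

definition particle_solution ::
  "'a measure \<Rightarrow> nat \<Rightarrow> (real \<Rightarrow> real) \<Rightarrow> real \<Rightarrow> (nat \<Rightarrow> 'a \<Rightarrow> real) \<Rightarrow>
   (nat \<Rightarrow> real \<Rightarrow> 'a \<Rightarrow> real) \<Rightarrow> (nat \<Rightarrow> real \<Rightarrow> 'a \<Rightarrow> real) \<Rightarrow> (real \<Rightarrow> 'a \<Rightarrow> real) \<Rightarrow> bool" where
  "particle_solution M N G \<beta> Z B X L \<longleftrightarrow>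
     (\<forall>\<omega>\<in>space M. (\<lambda>t. L t \<omega>) \<in> MM) \<and>
     (\<forall>t\<ge>0. L t \<in> borel_measurable (particle_filtration M N Z B t)) \<and>
     (AE \<omega> in M. \<forall>t\<ge>0.
        (\<forall>i\<in>{1..N}. X i t \<omega> = Z i \<omega> + \<beta> * t + B i t \<omega> - G (L t \<omega>)) \<and>
        L t \<omega> = (\<Sum>i=1..N. if hitting_time (\<lambda>s. X i s \<omega>) \<le> ereal t then 1 else 0) / real N)"

definition particle_minimal_solution where
  "particle_minimal_solution M N G \<beta> Z B X L \<longleftrightarrow>
     particle_solution M N G \<beta> Z B X L \<and>
     (\<forall>X' L'. particle_solution M N G \<beta> Z B X' L' \<longrightarrow> (AE \<omega> in M. \<forall>t\<ge>0. L t \<omega> \<le> L' t \<omega>))"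

definition MV_setting :: "'a measure \<Rightarrow> ('a \<Rightarrow> real) \<Rightarrow> (real \<Rightarrow> 'a \<Rightarrow> real) \<Rightarrow> bool" where
  "MV_setting M Z B \<longleftrightarrow>
     prob_space M \<and> Z \<in> borel_measurable M \<and> std_BM M B \<and>
     prob_space.indep_set M (sets (vimage_algebra (space M) Z borel))
       (sets (vimage_algebra (space M) (path B) path_space))"

definition MV_solution ::
  "'a measure \<Rightarrow> (real \<Rightarrow> real) \<Rightarrow> real \<Rightarrow> ('a \<Rightarrow> real) \<Rightarrow> (real \<Rightarrow> 'a \<Rightarrow> real) \<Rightarrow>
   (real \<Rightarrow> 'a \<Rightarrow> real) \<Rightarrow> (real \<Rightarrow> real) \<Rightarrow> bool" where
  "MV_solution M G \<beta> Z B X \<Lambda> \<longleftrightarrow>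
     \<Lambda> \<in> MM \<and>
     (\<forall>\<omega>\<in>space M. \<forall>t\<ge>0. X t \<omega> = Z \<omega> + \<beta> * t + B t \<omega> - G (\<Lambda> t)) \<and>
     (\<forall>t\<ge>0. \<Lambda> t = measure M {\<omega>\<in>space M. hitting_time (\<lambda>s. X s \<omega>) \<le> ereal t})"

definition MV_minimal_solution where
  "MV_minimal_solution M G \<beta> Z B X \<Lambda> \<longleftrightarrow>
     MV_solution M G \<beta> Z B X \<Lambda> \<and>
     (\<forall>X' \<Lambda>'. MV_solution M G \<beta> Z B X' \<Lambda>' \<longrightarrow> (\<forall>t\<ge>0. \<Lambda> t \<le> \<Lambda>' t))"

definition lim_infty :: "(real \<Rightarrow> real) \<Rightarrow> real" where
  "lim_infty l = Lim at_top l"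

end

theory Submission
  imports Defs
begin

text \<open>
  Particle system: for each sample point the map sending a loss path to the fraction of particles it
  absorbs is monotone, and its iterates starting from \<open>0\<close> become stationary after \<open>N\<close> steps. The
  limit is therefore the least solution, and it is adapted because each iterate is.

  McKean--Vlasov equation: the map \<open>\<Lambda> \<mapsto> P(\<tau> \<le> \<cdot>)\<close> is monotone on \<open>MM\<close>, and \<open>MM\<close> is closed under
  pointwise infima since a non-decreasing function is right-continuous iff it is upper
  semicontinuous. Hence the infimum of all supersolutions is the least fixed point.

  Strictness: suppose another solution exceeds the minimal one at time \<open>t\<close>. With positive probability
  a particle has been absorbed by time \<open>t\<close> for the larger solution but not for the minimal one. From
  then on, independently of the past and with positive probability, the Brownian motion climbs
  above any given level without dipping appreciably first, and afterwards, thanks to the positive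
  drift, it never returns. Such a particle is never absorbed in the minimal solution, so the
  two limits differ by at least the probability of this scenario.
\<close>

subsection \<open>Loss paths and hitting of barriers\<close>

text \<open>Pointwise suprema of right-continuous monotone functions need not be right-continuous,
  so iterating upwards from \<open>0\<close> could leave \<open>MM\<close> in the limit. This is why
  the McKean-Vlasov part works downwards, through infima. The particle part can iterate upwards
  because its loss takes at most \<open>N + 1\<close> values; this also yields adaptedness, which an
  uncountable infimum need not inherit. Both parts rest on one topological fact: a continuous path
  and a monotone right-continuous barrier have a closed crossing set, so the hitting time is
  attained. In the strictness argument the minimal loss may grow right after \<open>t\<close>, and
  right-continuity keeps the barrier low only on a short window of length \<open>d\<close>. The
  escape must take place within \<open>d\<close>, although the height to be gained does not shrink
  with \<open>d\<close>; hence the many small climbs. That dips are small over short times and that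
  a positive drift prevents a return both follow from one maximal inequality for the exponential
  martingale.\<close>

text \<open>Monotonicity traps \<open>f\<close> between \<open>f t\<close> and \<open>f s\<close> on
  \<open>{t<..<s}\<close>, so one good point \<open>s\<close> is enough. In this form
  right-continuity passes to infima and to hitting indicators.\<close>

lemma mono_tendsto_at_right:
  fixes f :: "real \<Rightarrow> real"
  assumes mono: "mono_on {a..} f" and "a \<le> t"
    and approx: "\<And>e. 0 < e \<Longrightarrow> \<exists>s>t. f s < f t + e"
  shows "(f \<longlongrightarrow> f t) (at_right t)"
proof (rule tendstoI)
  fix e :: real assume "0 < e"
  then obtain s where s: "t < s" "f s < f t + e" using approx by blast
  have "\<forall>u\<in>{t<..<s}. dist (f u) (f t) < e"
  proof
    fix u assume "u \<in> {t<..<s}"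
    then have "f t \<le> f u" "f u \<le> f s"
      using \<open>a \<le> t\<close> by (auto intro!: mono_onD[OF mono])
    then show "dist (f u) (f t) < e" using s by (auto simp: dist_real_def)
  qed
  then show "\<forall>\<^sub>F u in at_right t. dist (f u) (f t) < e"
    using s by (auto simp: eventually_at_right_field intro!: exI[of _ s])
qed

text \<open>Left limits and the limit at infinity exist automatically as suprema of a bounded
  monotone function, and right-continuity before \<open>0\<close> is trivial because the path is
  constant there.\<close>

lemma MM_intro:
  assumes mono: "mono_on {-1..} l" and zero: "\<And>t. t \<in> {-1..<0} \<Longrightarrow> l t = 0"
    and le1: "\<And>t. 0 \<le> t \<Longrightarrow> l t \<le> 1"
    and rc: "\<And>t. 0 \<le> t \<Longrightarrow> (l \<longlongrightarrow> l t) (at_right t)"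
  shows "l \<in> MM"
proof -
  have right: "(l \<longlongrightarrow> l t) (at_right t)" if "-1 \<le> t" for t
  proof (cases "t < 0")
    case True
    then have "\<forall>\<^sub>F s in at_right t. l s = l t"
      using that zero by (auto simp: eventually_at_right_field intro!: exI[of _ 0])
    then show ?thesis by (rule tendsto_eventually)
  qed (use rc in auto)
  have left: "\<exists>c. (l \<longlongrightarrow> c) (at_left t)" if "-1 < t" for t
  proof -
    have "(l \<longlongrightarrow> Sup (l ` ({..<t} \<inter> {-1<..<t}))) (at t within ({..<t} \<inter> {-1<..<t}))"
      by (rule Lim_left_bound[where K = "l t"]) (auto intro!: mono_onD[OF mono])
    moreover have "at t within ({..<t} \<inter> {-1<..<t}) = at_left t"
      using that by (intro at_within_nhd[where S="{-1<..}"]) auto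
    ultimately show ?thesis by auto
  qed
  have le1': "l t \<le> 1" if "-1 \<le> t" for t
    using le1[of t] zero[of t] that by (cases "t < 0") auto
  define c where "c = Sup (l ` {0..})"
  have bdd: "bdd_above (l ` {0..})" using le1 by (auto intro!: bdd_aboveI[of _ 1])
  have "(l \<longlongrightarrow> c) at_top"
  proof (rule increasing_tendsto)
    show "\<forall>\<^sub>F t in at_top. l t \<le> c"
      using eventually_ge_at_top[of 0] by eventually_elim (auto simp: c_def intro!: cSUP_upper bdd)
    fix x assume "x < c"
    then obtain s where s: "0 \<le> s" "x < l s"
      unfolding c_def using less_cSUP_iff[OF _ bdd] by auto
    show "\<forall>\<^sub>F t in at_top. x < l t"
      using eventually_ge_at_top[of s]
    proof eventually_elim
      fix t assume "s \<le> t"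
      then have "l s \<le> l t" using s by (auto intro!: mono_onD[OF mono])
      then show "x < l t" using s by simp
    qed
  qed
  moreover have "c \<le> 1" unfolding c_def by (rule cSUP_least) (use le1 in auto)
  ultimately show ?thesis
    unfolding MM_def cadlag_def using right left mono zero by auto
qed

lemma MM_mono: "l \<in> MM \<Longrightarrow> mono_on {-1..} l"
  by (simp add: MM_def)

lemma MM_at_right: "l \<in> MM \<Longrightarrow> 0 \<le> t \<Longrightarrow> (l \<longlongrightarrow> l t) (at_right t)"
  by (simp add: MM_def cadlag_def)

lemma MM_tendsto_lim_infty:
  assumes "l \<in> MM" shows "(l \<longlongrightarrow> lim_infty l) at_top"
  using assms tendsto_Lim[of at_top l] by (auto simp: MM_def lim_infty_def)

lemma MM_nonneg: assumes "l \<in> MM" "0 \<le> t" shows "0 \<le> l t"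
proof -
  have "l (-1) = 0" using assms by (auto simp: MM_def)
  moreover have "l (-1) \<le> l t" using assms by (intro mono_onD[OF MM_mono[OF assms(1)]]) auto
  ultimately show ?thesis by simp
qed

lemma MM_le_one: assumes "l \<in> MM" "0 \<le> t" shows "l t \<le> 1"
proof -
  obtain c where c: "(l \<longlongrightarrow> c) at_top" "c \<le> 1" using assms by (auto simp: MM_def)
  have "l t \<le> c"
  proof (rule tendsto_lowerbound[OF c(1)])
    show "\<forall>\<^sub>F s in at_top. l t \<le> l s"
      using eventually_ge_at_top[of t]
      by eventually_elim (use assms in \<open>auto intro!: mono_onD[OF MM_mono[OF assms(1)]]\<close>)
  qed simp
  then show ?thesis using c by simp
qed

text \<open>The event \<open>\<tau> \<le> t\<close> with the crossing attained at some
  \<open>s \<le> t\<close> instead of encoded by an infimum; monotonicity in barrier and time is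
  then immediate.\<close>

definition hits :: "(real \<Rightarrow> real) \<Rightarrow> (real \<Rightarrow> real) \<Rightarrow> real \<Rightarrow> bool" where
  "hits c g t \<longleftrightarrow> (\<exists>s\<in>{0..t}. c s \<le> g s)"

lemma hits_mono_time: "hits c g s \<Longrightarrow> s \<le> t \<Longrightarrow> hits c g t"
  by (force simp: hits_def)

lemma hits_mono: "hits c g t \<Longrightarrow> (\<And>s. s \<in> {0..t} \<Longrightarrow> g s \<le> g' s) \<Longrightarrow> hits c g' t"
  by (force simp: hits_def)

lemma not_hits_neg: "t < 0 \<Longrightarrow> \<not> hits c g t"
  by (auto simp: hits_def)

text \<open>These two conditions make \<open>g\<close> upper semicontinuous: to the left of a point
  monotonicity controls it, to the right right-continuity does. For continuous \<open>c\<close> the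
  set where \<open>c \<le> g\<close> is then closed.\<close>

locale barrier =
  fixes g :: "real \<Rightarrow> real"
  assumes mono: "mono_on {0..} g"
    and at_right: "\<And>t. 0 \<le> t \<Longrightarrow> (g \<longlongrightarrow> g t) (at_right t)"
begin

lemma upper_semicontinuous:
  assumes u: "u \<longlonglongrightarrow> s" "0 \<le> s" "\<And>n. 0 \<le> u n" and "0 < e"
  shows "\<forall>\<^sub>F n in sequentially. g (u n) < g s + e"
proof -
  have "\<forall>\<^sub>F r in at_right s. g r < g s + e"
    using order_tendstoD(2)[OF at_right[OF u(2)]] \<open>0 < e\<close> by simp
  then obtain b where b: "s < b" "\<And>r. s < r \<Longrightarrow> r < b \<Longrightarrow> g r < g s + e"
    by (auto simp: eventually_at_right_field)
  have "\<forall>\<^sub>F n in sequentially. u n < b" using order_tendstoD(2)[OF u(1) b(1)] .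
  then show ?thesis
  proof eventually_elim
    fix n assume "u n < b"
    show "g (u n) < g s + e"
    proof (cases "s < u n")
      case False
      then have "g (u n) \<le> g s" using u by (auto intro!: mono_onD[OF mono])
      then show ?thesis using \<open>0 < e\<close> by simp
    qed (use b \<open>u n < b\<close> in auto)
  qed
qed

text \<open>The near-crossings \<open>u n\<close> stay in a compact interval, so a subsequence
  converges to some \<open>s \<le> t\<close>, where continuity of \<open>c\<close> and upper
  semicontinuity of \<open>g\<close> yield a true crossing. The moving endpoints \<open>S n\<close>
  serve right-continuity in time, the errors \<open>e n\<close> the reduction to rational
  times.\<close>

lemma hits_limit:
  assumes c: "continuous_on {0..} c"
    and u: "\<And>n. u n \<in> {0..S n}" "\<And>n. c (u n) \<le> g (u n) + e n"
    and S: "S \<longlonglongrightarrow> t" and e: "e \<longlonglongrightarrow> 0"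
  shows "hits c g t"
proof -
  have "bounded (range S)" using S by (rule convergent_imp_bounded)
  then obtain K where K: "\<And>n. \<bar>S n\<bar> \<le> K" unfolding bounded_iff by auto
  have "u n \<in> {0..K}" for n using u(1)[of n] K[of n] by auto
  then obtain s r where s: "s \<in> {0..K}" and r: "strict_mono r" and lim: "(u \<circ> r) \<longlonglongrightarrow> s"
    using compact_Icc[of 0 K] unfolding compact_def by metis
  have "s \<le> t"
  proof (rule tendsto_le[OF _ LIMSEQ_subseq_LIMSEQ[OF S r] lim])
    show "\<forall>\<^sub>F n in sequentially. (u \<circ> r) n \<le> (S \<circ> r) n" using u(1) by auto
  qed simp
  have "\<forall>n. (u \<circ> r) n \<in> {0..}" using u(1) by auto
  then have "(c \<circ> (u \<circ> r)) \<longlonglongrightarrow> c s"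
    using c s lim unfolding continuous_on_sequentially by (metis atLeast_iff atLeastAtMost_iff)
  then have clim: "(\<lambda>n. c (u (r n))) \<longlonglongrightarrow> c s" by (simp add: o_def)
  have elim: "(\<lambda>n. e (r n)) \<longlonglongrightarrow> 0" using LIMSEQ_subseq_LIMSEQ[OF e r] by (simp add: o_def)
  have "c s \<le> g s"
  proof (rule field_le_epsilon)
    fix d :: real assume "0 < d"
    have "(\<lambda>n. c (u (r n)) - e (r n)) \<longlonglongrightarrow> c s - 0" by (intro tendsto_diff clim elim)
    moreover have "\<forall>\<^sub>F n in sequentially. c (u (r n)) - e (r n) \<le> g s + d"
    proof -
      have "\<forall>\<^sub>F n in sequentially. g ((u \<circ> r) n) < g s + d"
        by (rule upper_semicontinuous[OF lim]) (use s u \<open>0 < d\<close> in auto)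
      then show ?thesis
      proof eventually_elim
        fix n assume "g ((u \<circ> r) n) < g s + d"
        then show "c (u (r n)) - e (r n) \<le> g s + d" using u(2)[of "r n"] by simp
      qed
    qed
    ultimately have "c s - 0 \<le> g s + d" by (intro tendsto_upperbound) auto
    then show "c s \<le> g s + d" by simp
  qed
  with s \<open>s \<le> t\<close> show ?thesis by (auto simp: hits_def)
qed

text \<open>Forwards, a crossing time \<open>s < t\<close> is approximated by rationals from the
  right, the side on which \<open>g\<close> converges to \<open>g s\<close>; \<open>t\<close> is
  inserted separately because no point of \<open>{0..t}\<close> lies to its right. Backwards, the
  vanishing slack is absorbed by \<open>hits_limit\<close>.\<close>

lemma hits_iff_rational:
  assumes c: "continuous_on {0..} c" and "0 \<le> t"
  shows "hits c g t \<longleftrightarrow> (\<forall>n. \<exists>q\<in>insert t (\<rat> \<inter> {0..t}). c q - g q < 1 / real (Suc n))"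
proof
  assume "hits c g t"
  then obtain s where s: "0 \<le> s" "s \<le> t" "c s \<le> g s" by (auto simp: hits_def)
  show "\<forall>n. \<exists>q\<in>insert t (\<rat> \<inter> {0..t}). c q - g q < 1 / real (Suc n)"
  proof
    fix n :: nat
    show "\<exists>q\<in>insert t (\<rat> \<inter> {0..t}). c q - g q < 1 / real (Suc n)"
    proof (cases "s = t")
      case True
      then show ?thesis using s by (intro bexI[of _ t]) (auto intro: le_less_trans[of _ 0])
    next
      case False
      have "(c \<longlongrightarrow> c s) (at s within {0..})" using c s by (auto simp: continuous_on_def)
      then have "(c \<longlongrightarrow> c s) (at_right s)" by (rule tendsto_within_subset) (use s in auto)
      then have "((\<lambda>r. c r - g r) \<longlongrightarrow> c s - g s) (at_right s)"
        by (intro tendsto_diff at_right s)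
      moreover have "c s - g s < 1 / real (Suc n)" using s by (auto intro: le_less_trans[of _ 0])
      ultimately have "\<forall>\<^sub>F r in at_right s. c r - g r < 1 / real (Suc n)"
        by (rule order_tendstoD)
      then obtain b where b: "s < b" "\<And>r. s < r \<Longrightarrow> r < b \<Longrightarrow> c r - g r < 1 / real (Suc n)"
        by (auto simp: eventually_at_right_field)
      obtain q where "q \<in> \<rat>" "s < q" "q < min b t"
        using Rats_dense_in_real[of s "min b t"] b False s by auto
      then show ?thesis using b s by (intro bexI[of _ q]) auto
    qed
  qed
next
  assume *: "\<forall>n. \<exists>q\<in>insert t (\<rat> \<inter> {0..t}). c q - g q < 1 / real (Suc n)"
  then obtain u where u: "\<And>n. u n \<in> insert t (\<rat> \<inter> {0..t})"
      "\<And>n. c (u n) - g (u n) < 1 / real (Suc n)"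
    by metis
  have "u n \<in> {0..t}" "c (u n) \<le> g (u n) + 1 / real (Suc n)" for n
    using u[of n] \<open>0 \<le> t\<close> by auto
  moreover have "(\<lambda>n. 1 / real (Suc n)) \<longlonglongrightarrow> 0" using LIMSEQ_inverse_real_of_nat by (simp add: inverse_eq_divide)
  ultimately show "hits c g t" by (intro hits_limit[OF c, where S="\<lambda>_. t" and u=u]) auto
qed

lemma hits_later:
  assumes c: "continuous_on {0..} c" and later: "\<And>n. hits c g (S n)" and S: "S \<longlonglongrightarrow> t"
  shows "hits c g t"
proof -
  obtain u where "\<And>n. u n \<in> {0..S n}" "\<And>n. c (u n) \<le> g (u n)"
    using later unfolding hits_def by metis
  then show ?thesis by (intro hits_limit[OF c _ _ S, where e="\<lambda>_. 0" and u=u]) auto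
qed

text \<open>An infimum of at most \<open>t\<close> only gives crossings before each
  \<open>t + 1 / (n + 1)\<close>; \<open>hits_later\<close> turns these into one by time
  \<open>t\<close>.\<close>

lemma hitting_time_le_iff:
  assumes c: "continuous_on {0..} c"
  shows "hitting_time (\<lambda>s. c s - g s) \<le> ereal t \<longleftrightarrow> hits c g t"
proof
  assume "hits c g t"
  then obtain s where "0 \<le> s" "s \<le> t" "c s \<le> g s" by (auto simp: hits_def)
  then have "hitting_time (\<lambda>s. c s - g s) \<le> ereal s"
    unfolding hitting_time_def by (intro Inf_lower) auto
  also have "\<dots> \<le> ereal t" using \<open>s \<le> t\<close> by simp
  finally show "hitting_time (\<lambda>s. c s - g s) \<le> ereal t" .
next
  assume le: "hitting_time (\<lambda>s. c s - g s) \<le> ereal t"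
  have "hits c g (t + inverse (real (Suc n)))" for n
  proof -
    have "hitting_time (\<lambda>s. c s - g s) < ereal (t + inverse (real (Suc n)))"
      using le by (rule le_less_trans) simp
    then obtain s where "0 \<le> s" "c s \<le> g s" "s < t + inverse (real (Suc n))"
      unfolding hitting_time_def Inf_less_iff by auto
    then show ?thesis by (force simp: hits_def)
  qed
  then show "hits c g t" using LIMSEQ_inverse_real_of_nat_add by (rule hits_later[OF c])
qed

end

text \<open>Measurability is asked only at times up to \<open>t\<close>, so the lemma applies to the
  full sigma-algebra and to those of the past alike.\<close>

lemma hits_measurable:
  assumes barrier: "\<And>\<omega>. \<omega> \<in> space M \<Longrightarrow> barrier (\<lambda>s. g s \<omega>)"
    and cont: "\<And>\<omega>. \<omega> \<in> space M \<Longrightarrow> continuous_on {0..} (\<lambda>s. c s \<omega>)"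
    and meas: "\<And>s. s \<in> {0..t} \<Longrightarrow> c s \<in> borel_measurable M"
      "\<And>s. s \<in> {0..t} \<Longrightarrow> g s \<in> borel_measurable M"
  shows "{\<omega> \<in> space M. hits (\<lambda>s. c s \<omega>) (\<lambda>s. g s \<omega>) t} \<in> sets M"
proof (cases "0 \<le> t")
  case True
  have "{\<omega> \<in> space M. hits (\<lambda>s. c s \<omega>) (\<lambda>s. g s \<omega>) t} =
      {\<omega> \<in> space M. \<forall>n. \<exists>q\<in>insert t (\<rat> \<inter> {0..t}). c q \<omega> - g q \<omega> < 1 / real (Suc n)}"
    using barrier.hits_iff_rational[OF barrier cont True] by auto
  also have "\<dots> \<in> sets M"
  proof (intro sets.sets_Collect_countable_All sets.sets_Collect_countable_Ex')
    show "countable (insert t (\<rat> \<inter> {0..t}))" using countable_rat by auto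
    fix q and n :: nat assume "q \<in> insert t (\<rat> \<inter> {0..t})"
    then have [measurable]: "c q \<in> borel_measurable M" "g q \<in> borel_measurable M"
      using meas True by auto
    show "{\<omega> \<in> space M. c q \<omega> - g q \<omega> < 1 / real (Suc n)} \<in> sets M" by measurable
  qed
  finally show ?thesis .
qed (use not_hits_neg in auto)

locale feedback =
  fixes G :: "real \<Rightarrow> real"
  assumes cont: "continuous_on {-1..1} G" and mono: "mono_on {-1..1} G"
begin

lemma barrier_MM:
  assumes l: "l \<in> MM" shows "barrier (\<lambda>t. G (l t))"
proof
  show "mono_on {0..} (\<lambda>t. G (l t))"
  proof (rule mono_onI)
    fix s t :: real assume "s \<in> {0..}" "t \<in> {0..}" "s \<le> t"
    then show "G (l s) \<le> G (l t)"
      using MM_nonneg[OF l, of s] MM_le_one[OF l, of s] MM_nonneg[OF l, of t] MM_le_one[OF l, of t]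
      by (intro mono_onD[OF mono] mono_onD[OF MM_mono[OF l]]) auto
  qed
  fix t :: real assume "0 \<le> t"
  have "l s \<in> {-1..1}" if "0 \<le> s" for s
    using MM_nonneg[OF l that] MM_le_one[OF l that] by auto
  then have "\<forall>\<^sub>F s in at_right t. l s \<in> {-1..1}"
    using \<open>0 \<le> t\<close> by (auto simp: eventually_at_right_field intro!: exI[of _ "t + 1"])
  then show "((\<lambda>t. G (l t)) \<longlongrightarrow> G (l t)) (at_right t)"
    using MM_nonneg[OF l \<open>0 \<le> t\<close>] MM_le_one[OF l \<open>0 \<le> t\<close>]
    by (intro continuous_on_tendsto_compose[OF cont MM_at_right[OF l \<open>0 \<le> t\<close>]]) auto
qed

lemma G_comp_mono:
  assumes "0 \<le> a" "a \<le> b" "b \<le> 1" shows "G a \<le> G b"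
  using assms by (intro mono_onD[OF mono]) auto

end

lemma hitting_time_cong:
  "(\<And>s. 0 \<le> s \<Longrightarrow> x s = y s) \<Longrightarrow> hitting_time x = hitting_time y"
  unfolding hitting_time_def by (rule arg_cong[where f=Inf]) auto

text \<open>\<open>hits_later\<close> read contrapositively: without a hit by time \<open>t\<close>
  there is none shortly afterwards.\<close>

lemma (in barrier) hits_at_right:
  assumes c: "continuous_on {0..} c"
  shows "((\<lambda>t. if hits c g t then 1 else 0 :: real) \<longlongrightarrow> (if hits c g t then 1 else 0)) (at_right t)"
proof (rule mono_tendsto_at_right[where a=t])
  show "mono_on {t..} (\<lambda>t. if hits c g t then 1 else 0 :: real)"
    by (intro mono_onI) (use hits_mono_time in auto)
  fix e :: real assume "0 < e"
  have "\<exists>s>t. hits c g s \<longrightarrow> hits c g t"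
  proof (rule ccontr)
    assume *: "\<not> ?thesis"
    have "hits c g (t + inverse (real (Suc n)))" for n
      using * by (metis less_add_same_cancel1 of_nat_0_less_iff zero_less_Suc inverse_positive_iff_positive)
    then have "hits c g t" using LIMSEQ_inverse_real_of_nat_add by (rule hits_later[OF c])
    moreover have "\<not> hits c g t" using * gt_ex[of t] by blast
    ultimately show False by simp
  qed
  then show "\<exists>s>t. (if hits c g s then 1 else 0) < (if hits c g t then 1 else 0) + e"
    using \<open>0 < e\<close> by (smt (verit))
qed simp

subsection \<open>The particle system\<close>

text \<open>One step of the particle dynamics at a fixed sample point: \<open>c i\<close> is the
  \<open>i\<close>-th free path and \<open>g\<close> the common barrier created by the
  losses.\<close>

definition hit_fraction :: "nat \<Rightarrow> (nat \<Rightarrow> real \<Rightarrow> real) \<Rightarrow> (real \<Rightarrow> real) \<Rightarrow> real \<Rightarrow> real" where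
  "hit_fraction N c g t = (\<Sum>i=1..N. if hits (c i) g t then 1 else 0) / real N"

lemma hit_fraction_card: "hit_fraction N c g t = real (card {i\<in>{1..N}. hits (c i) g t}) / real N"
  by (simp add: hit_fraction_def flip: sum.inter_filter)

lemma hit_fraction_neg: "t < 0 \<Longrightarrow> hit_fraction N c g t = 0"
  by (simp add: hit_fraction_def not_hits_neg)

lemma hit_fraction_mono:
  assumes "\<And>s. s \<in> {0..t} \<Longrightarrow> g s \<le> g' s"
  shows "hit_fraction N c g t \<le> hit_fraction N c g' t"
  unfolding hit_fraction_def
  by (intro divide_right_mono sum_mono) (use hits_mono[OF _ assms] in auto)

text \<open>Both sides are multiples of \<open>1 / N\<close>. Paths, barriers and times may differ,
  so that a comparison with the value \<open>0\<close> at a negative time is covered as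
  well.\<close>

lemma hit_fraction_less:
  assumes "hit_fraction N c g t < hit_fraction N c' g' t'"
  shows "hit_fraction N c g t + 1 / real N \<le> hit_fraction N c' g' t'"
proof -
  have "0 < N" using assms by (cases N) (auto simp: hit_fraction_card)
  then have "card {i\<in>{1..N}. hits (c i) g t} + 1 \<le> card {i\<in>{1..N}. hits (c' i) g' t'}"
    using assms by (auto simp: hit_fraction_card divide_less_cancel)
  then have "real (card {i\<in>{1..N}. hits (c i) g t} + 1) / N \<le> card {i\<in>{1..N}. hits (c' i) g' t'} / N"
    by (intro divide_right_mono) (simp_all only: of_nat_le_iff of_nat_0_le_iff)
  then show ?thesis by (simp add: hit_fraction_card add_divide_distrib)
qed

lemma hit_fraction_le_one: "hit_fraction N c g t \<le> 1"
proof -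
  have "card {i\<in>{1..N}. hits (c i) g t} \<le> card {1..N}" by (intro card_mono) auto
  then show ?thesis by (auto simp: hit_fraction_card divide_le_eq)
qed

lemma (in barrier) hit_fraction_MM:
  assumes c: "\<And>i. i \<in> {1..N} \<Longrightarrow> continuous_on {0..} (c i)"
  shows "hit_fraction N c g \<in> MM"
proof (rule MM_intro)
  show "mono_on {-1..} (hit_fraction N c g)"
    unfolding hit_fraction_def
    by (intro mono_onI divide_right_mono sum_mono) (use hits_mono_time in auto)
  show "(hit_fraction N c g \<longlongrightarrow> hit_fraction N c g t) (at_right t)" for t
    unfolding hit_fraction_def divide_inverse
    by (intro tendsto_mult_right tendsto_sum hits_at_right c)
qed (use hit_fraction_neg hit_fraction_le_one in auto)

context feedback begin

definition picard :: "nat \<Rightarrow> (nat \<Rightarrow> real \<Rightarrow> real) \<Rightarrow> nat \<Rightarrow> real \<Rightarrow> real" where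
  "picard N c k = ((\<lambda>l. hit_fraction N c (\<lambda>s. G (l s))) ^^ k) (\<lambda>_. 0)"

lemma picard_0: "picard N c 0 t = 0"
  by (simp add: picard_def)

lemma picard_Suc: "picard N c (Suc k) = hit_fraction N c (\<lambda>s. G (picard N c k s))"
  by (simp add: picard_def)

context
  fixes N :: nat and c :: "nat \<Rightarrow> real \<Rightarrow> real"
  assumes c: "\<And>i. i \<in> {1..N} \<Longrightarrow> continuous_on {0..} (c i)"
begin

lemma picard_MM: "picard N c k \<in> MM"
proof (induction k)
  case 0
  show ?case by (rule MM_intro) (auto simp: picard_0 intro: mono_onI)
next
  case (Suc k)
  then show ?case unfolding picard_Suc by (intro barrier.hit_fraction_MM barrier_MM c)
qed

lemma picard_mono_step: "picard N c k t \<le> picard N c (Suc k) t"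
proof (induction k arbitrary: t)
  case 0
  show ?case by (simp add: picard_0 picard_Suc hit_fraction_card)
next
  case (Suc k)
  show ?case
    unfolding picard_Suc[of _ _ "Suc k"] picard_Suc[of _ _ k]
    by (rule hit_fraction_mono, unfold picard_Suc[symmetric], rule G_comp_mono)
       (use Suc MM_nonneg[OF picard_MM] MM_le_one[OF picard_MM] in auto)
qed

text \<open>
  If the iteration still moves at level \<open>k\<close> and time \<open>t\<close>, then it moved at level \<open>k - 1\<close> at some
  time before \<open>t\<close>; by induction at least \<open>k\<close> particles had been absorbed there already, and
  the new increment adds one more.
\<close>

lemma picard_gap:
  assumes "picard N c k t < picard N c (Suc k) t"
  shows "real (Suc k) / real N \<le> picard N c (Suc k) t"
  using assms
proof (induction k arbitrary: t)
  case 0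
  \<comment> \<open>The value at time \<open>-1\<close> stands in for \<open>0\<close>, which brings
    the base case under \<open>hit_fraction_less\<close>.\<close>
  have "hit_fraction N c (\<lambda>_. 0) (-1) = 0" by (rule hit_fraction_neg) simp
  then have "0 + 1 / real N \<le> picard N c (Suc 0) t"
    using 0 hit_fraction_less[of N c "\<lambda>_. 0" "-1" c "\<lambda>s. G (picard N c 0 s)" t]
    by (simp add: picard_Suc picard_0)
  then show ?case by simp
next
  case (Suc k)
  have "\<exists>s\<in>{0..t}. picard N c k s < picard N c (Suc k) s"
  proof (rule ccontr)
    assume *: "\<not> ?thesis"
    have "picard N c (Suc k) s = picard N c k s" if "s \<in> {0..t}" for s
      using picard_mono_step[of k s] * that by (meson antisym not_le)
    then have "picard N c (Suc (Suc k)) t \<le> picard N c (Suc k) t"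
      unfolding picard_Suc[of _ _ "Suc k"] by (subst (2) picard_Suc) (auto intro!: hit_fraction_mono)
    then show False using Suc.prems by simp
  qed
  then obtain s where s: "s \<in> {0..t}" "picard N c k s < picard N c (Suc k) s" by blast
  then have "real (Suc k) / real N \<le> picard N c (Suc k) s" by (intro Suc.IH)
  also have "\<dots> \<le> picard N c (Suc k) t"
    using s by (intro mono_onD[OF MM_mono[OF picard_MM]]) auto
  also have "picard N c (Suc k) t + 1 / real N \<le> picard N c (Suc (Suc k)) t"
    using Suc.prems unfolding picard_Suc[of _ _ "Suc k"] picard_Suc[of _ _ k] by (rule hit_fraction_less)
  finally show ?case by (simp add: add_divide_distrib)
qed

text \<open>A strict increase at level \<open>N\<close> would, by \<open>picard_gap\<close>, absorb
  a fraction of at least \<open>(N + 1) / N\<close> of the particles.\<close>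

lemma picard_fixpoint:
  assumes "1 \<le> N"
  shows "picard N c (Suc N) t = picard N c N t"
proof (rule antisym[OF leI picard_mono_step])
  show "\<not> picard N c N t < picard N c (Suc N) t"
  proof
    assume "picard N c N t < picard N c (Suc N) t"
    from picard_gap[OF this] have "real (Suc N) / real N \<le> 1"
      using hit_fraction_le_one[of N c "\<lambda>s. G (picard N c N s)" t] by (simp only: picard_Suc)
    then show False using \<open>1 \<le> N\<close> by (simp add: divide_le_eq)
  qed
qed

lemma picard_least:
  assumes l: "l \<in> MM" and fixpt: "\<And>t. 0 \<le> t \<Longrightarrow> l t = hit_fraction N c (\<lambda>s. G (l s)) t" and "0 \<le> t"
  shows "picard N c k t \<le> l t"
  using \<open>0 \<le> t\<close>
proof (induction k arbitrary: t)
  case 0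
  then show ?case using MM_nonneg[OF l] by (simp add: picard_0)
next
  case (Suc k)
  show ?case
    unfolding picard_Suc fixpt[OF Suc.prems]
    by (intro hit_fraction_mono G_comp_mono)
       (use Suc.IH MM_nonneg[OF picard_MM] MM_le_one[OF l] in auto)
qed

end

text \<open>\<open>G\<close> is arbitrary outside \<open>{-1..1}\<close>; clamping its argument to
  \<open>{0..1}\<close> gives a globally continuous function that agrees with it on the values of
  \<open>f\<close>.\<close>

lemma G_measurable:
  assumes "f \<in> borel_measurable M" "\<And>\<omega>. \<omega> \<in> space M \<Longrightarrow> 0 \<le> f \<omega> \<and> f \<omega> \<le> 1"
  shows "(\<lambda>\<omega>. G (f \<omega>)) \<in> borel_measurable M"
proof -
  have "continuous_on UNIV (\<lambda>x. G (max 0 (min 1 x)))"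
    by (rule continuous_on_compose2[OF cont]) (auto intro!: continuous_intros)
  then have "(\<lambda>x. G (max 0 (min 1 x))) \<in> borel_measurable borel"
    by (rule borel_measurable_continuous_onI)
  from measurable_compose[OF assms(1) this]
  show ?thesis by (rule measurable_cong[THEN iffD1, rotated]) (use assms(2) in auto)
qed

end

section \<open>Adaptedness of the iterates and the minimal particle system\<close>

lemma space_particle_filtration [simp]: "space (particle_filtration M N Z B t) = space M"
  unfolding particle_filtration_def by (rule space_measure_of) auto

lemma sets_particle_filtration:
  "sets (particle_filtration M N Z B t) = sigma_sets (space M)
     ((\<Union>i\<in>{1..N}. {Z i -` A \<inter> space M | A. A \<in> sets borel}) \<union>
      (\<Union>i\<in>{1..N}. \<Union>s\<in>{0..t}. {B i s -` A \<inter> space M | A. A \<in> sets borel}))"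
  unfolding particle_filtration_def by (rule sets_measure_of) auto

lemma particle_filtration_mono:
  "s \<le> t \<Longrightarrow> sets (particle_filtration M N Z B s) \<subseteq> sets (particle_filtration M N Z B t)"
  unfolding sets_particle_filtration
  by (intro sigma_sets_mono' Un_mono UN_mono subset_refl) auto

lemma initial_measurable_filtration:
  "i \<in> {1..N} \<Longrightarrow> Z i \<in> borel_measurable (particle_filtration M N Z B t)"
  by (rule measurableI) (auto simp: sets_particle_filtration intro!: sigma_sets.Basic)

lemma process_measurable_filtration:
  "i \<in> {1..N} \<Longrightarrow> s \<in> {0..t} \<Longrightarrow> B i s \<in> borel_measurable (particle_filtration M N Z B t)"
proof (rule measurableI)
  fix A :: "real set"
  assume "i \<in> {1..N}" "s \<in> {0..t}" "A \<in> sets borel"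
  then show "B i s -` A \<inter> space (particle_filtration M N Z B t) \<in> sets (particle_filtration M N Z B t)"
    unfolding sets_particle_filtration space_particle_filtration
    by (intro sigma_sets.Basic UnI2 UN_I[of i] UN_I[of s]) auto
qed auto

text \<open>The new iterate at time \<open>t\<close> sees the previous one only at times
  \<open>s \<le> t\<close>, where it is measurable with respect to the smaller sigma-algebra at
  \<open>s\<close>.\<close>

lemma (in feedback) picard_adapted:
  assumes cont: "\<And>\<omega> i. \<omega> \<in> space M \<Longrightarrow> i \<in> {1..N} \<Longrightarrow> continuous_on {0..} (\<lambda>s. c \<omega> i s)"
    and meas: "\<And>i s t. i \<in> {1..N} \<Longrightarrow> s \<in> {0..t} \<Longrightarrow>
      (\<lambda>\<omega>. c \<omega> i s) \<in> borel_measurable (particle_filtration M N Z B t)"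
    and "0 \<le> t"
  shows "(\<lambda>\<omega>. picard N (c \<omega>) k t) \<in> borel_measurable (particle_filtration M N Z B t)"
  using \<open>0 \<le> t\<close>
proof (induction k arbitrary: t)
  case 0
  show ?case by (simp add: picard_0)
next
  case (Suc k)
  have MM: "picard N (c \<omega>) k \<in> MM" if "\<omega> \<in> space M" for \<omega>
    using that by (intro picard_MM cont)
  have "(\<lambda>\<omega>. G (picard N (c \<omega>) k s)) \<in> borel_measurable (particle_filtration M N Z B t)"
    if "s \<in> {0..t}" for s
  proof (rule G_measurable)
    have "(\<lambda>\<omega>. picard N (c \<omega>) k s) \<in> borel_measurable (particle_filtration M N Z B s)"
      using that by (intro Suc.IH) auto
    then show "(\<lambda>\<omega>. picard N (c \<omega>) k s) \<in> borel_measurable (particle_filtration M N Z B t)"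
      by (rule measurable_mono[THEN subsetD, rotated 4])
         (use that particle_filtration_mono[of s t M N Z B] in auto)
  qed (use MM_nonneg[OF MM] MM_le_one[OF MM] that in auto)
  then have hit: "{\<omega> \<in> space (particle_filtration M N Z B t).
      hits (c \<omega> i) (\<lambda>s. G (picard N (c \<omega>) k s)) t} \<in> sets (particle_filtration M N Z B t)"
    if "i \<in> {1..N}" for i
    using that meas cont MM by (intro hits_measurable barrier_MM) auto
  show ?case
    unfolding picard_Suc hit_fraction_def
    by (intro borel_measurable_divide borel_measurable_sum measurable_If hit) auto
qed

text \<open>The solution is constructed for every sample point; null sets enter only through the
  competitors, whose equations hold almost surely. Two minimal solutions bound each other, and the
  loss then determines the positions.\<close>

lemma (in feedback) particle_system_minimal_solution:
  assumes setting: "particle_setting M N Z B"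
  shows "\<exists>X L. particle_minimal_solution M N G \<beta> Z B X L \<and>
    (\<forall>X' L'. particle_minimal_solution M N G \<beta> Z B X' L' \<longrightarrow>
      (AE \<omega> in M. \<forall>t\<ge>0. L' t \<omega> = L t \<omega> \<and> (\<forall>i\<in>{1..N}. X' i t \<omega> = X i t \<omega>)))"
proof -
  define c where "c \<omega> i t = Z i \<omega> + \<beta> * t + B i t \<omega>" for \<omega> i and t :: real
  define L where "L t \<omega> = picard N (c \<omega>) N t" for t \<omega>
  define X where "X i t \<omega> = c \<omega> i t - G (L t \<omega>)" for i \<omega> and t :: real
  have N: "1 \<le> N" using setting by (simp add: particle_setting_def)
  have cont_c: "continuous_on {0..} (c \<omega> i)" if "\<omega> \<in> space M" "i \<in> {1..N}" for \<omega> i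
    unfolding c_def using setting that
    by (intro continuous_intros) (auto simp: particle_setting_def std_BM_def)
  have MM: "(\<lambda>t. L t \<omega>) \<in> MM" if "\<omega> \<in> space M" for \<omega>
    unfolding L_def using that by (intro picard_MM cont_c)
  have fixpt: "hit_fraction N (c \<omega>) (\<lambda>s. G (l s)) t =
      (\<Sum>i=1..N. if hitting_time (\<lambda>s. c \<omega> i s - G (l s)) \<le> ereal t then 1 else 0) / real N"
    if "\<omega> \<in> space M" "l \<in> MM" for \<omega> t l
    using that by (auto simp: hit_fraction_def barrier.hitting_time_le_iff[OF barrier_MM cont_c])
  have sol: "particle_solution M N G \<beta> Z B X L"
    unfolding particle_solution_def
  proof (intro conjI ballI allI impI AE_I2)
    show "(\<lambda>t. L t \<omega>) \<in> MM" if "\<omega> \<in> space M" for \<omega> using MM that .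
    show "L t \<in> borel_measurable (particle_filtration M N Z B t)" if "0 \<le> t" for t :: real
      unfolding L_def
    proof (rule picard_adapted[OF _ _ that])
      show "continuous_on {0..} (\<lambda>s. c \<omega> i s)" if "\<omega> \<in> space M" "i \<in> {1..N}" for \<omega> i
        using cont_c[OF that] .
      fix i and s t :: real assume "i \<in> {1..N}" "s \<in> {0..t}"
      then have [measurable]: "Z i \<in> borel_measurable (particle_filtration M N Z B t)"
          "B i s \<in> borel_measurable (particle_filtration M N Z B t)"
        by (auto intro: initial_measurable_filtration process_measurable_filtration)
      show "(\<lambda>\<omega>. c \<omega> i s) \<in> borel_measurable (particle_filtration M N Z B t)"
        unfolding c_def by measurable
    qed
    fix \<omega> and t :: real assume \<omega>: "\<omega> \<in> space M" and "0 \<le> t"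
    show "X i t \<omega> = Z i \<omega> + \<beta> * t + B i t \<omega> - G (L t \<omega>)" for i
      by (simp add: X_def c_def)
    have "L t \<omega> = picard N (c \<omega>) (Suc N) t"
      unfolding L_def by (rule picard_fixpoint[symmetric]) (use cont_c[OF \<omega>] N in auto)
    also have "\<dots> = hit_fraction N (c \<omega>) (\<lambda>s. G (L s \<omega>)) t"
      by (simp add: picard_Suc L_def)
    finally show "L t \<omega> = (\<Sum>i=1..N. if hitting_time (\<lambda>s. X i s \<omega>) \<le> ereal t then 1 else 0) / real N"
      using fixpt[OF \<omega> MM[OF \<omega>]] by (simp add: X_def)
  qed
  have least: "AE \<omega> in M. \<forall>t\<ge>0. L t \<omega> \<le> L' t \<omega>" if sol': "particle_solution M N G \<beta> Z B X' L'" for X' L'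
  proof -
    have "AE \<omega> in M. \<forall>t\<ge>0. (\<forall>i\<in>{1..N}. X' i t \<omega> = c \<omega> i t - G (L' t \<omega>)) \<and>
        L' t \<omega> = (\<Sum>i=1..N. if hitting_time (\<lambda>s. X' i s \<omega>) \<le> ereal t then 1 else 0) / real N"
      using sol' by (simp add: particle_solution_def c_def)
    then show ?thesis
    proof (rule AE_mp, intro AE_I2 impI allI)
      fix \<omega> and t :: real
      assume \<omega>: "\<omega> \<in> space M" and "0 \<le> t" and eq: "\<forall>t\<ge>0. (\<forall>i\<in>{1..N}. X' i t \<omega> = c \<omega> i t - G (L' t \<omega>)) \<and>
        L' t \<omega> = (\<Sum>i=1..N. if hitting_time (\<lambda>s. X' i s \<omega>) \<le> ereal t then 1 else 0) / real N"
      have MM': "(\<lambda>t. L' t \<omega>) \<in> MM" using sol' \<omega> by (simp add: particle_solution_def)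
      \<comment> \<open>The equations fix \<open>X'\<close> only at nonnegative times, which are all
        that the hitting time sees.\<close>
      have "hitting_time (\<lambda>s. X' i s \<omega>) = hitting_time (\<lambda>s. c \<omega> i s - G (L' s \<omega>))" if "i \<in> {1..N}" for i
        by (rule hitting_time_cong) (use eq that in auto)
      then have "L' t \<omega> = hit_fraction N (c \<omega>) (\<lambda>s. G (L' s \<omega>)) t" if "0 \<le> t" for t
        using eq that by (simp add: fixpt[OF \<omega> MM'])
      then show "L t \<omega> \<le> L' t \<omega>"
        unfolding L_def by (intro picard_least[OF cont_c[OF \<omega>] MM' _ \<open>0 \<le> t\<close>])
    qed
  qed
  have "AE \<omega> in M. \<forall>t\<ge>0. L' t \<omega> = L t \<omega> \<and> (\<forall>i\<in>{1..N}. X' i t \<omega> = X i t \<omega>)"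
    if min: "particle_minimal_solution M N G \<beta> Z B X' L'" for X' L'
  proof -
    have sol': "particle_solution M N G \<beta> Z B X' L'" and le: "AE \<omega> in M. \<forall>t\<ge>0. L' t \<omega> \<le> L t \<omega>"
      using min sol by (auto simp: particle_minimal_solution_def)
    have eq: "AE \<omega> in M. \<forall>t\<ge>0. (\<forall>i\<in>{1..N}. X' i t \<omega> = c \<omega> i t - G (L' t \<omega>)) \<and>
        L' t \<omega> = (\<Sum>i=1..N. if hitting_time (\<lambda>s. X' i s \<omega>) \<le> ereal t then 1 else 0) / real N"
      using sol' by (simp add: particle_solution_def c_def)
    show ?thesis
      using le least[OF sol'] eq
    proof eventually_elim
      case (elim \<omega>)
      then have "L' t \<omega> = L t \<omega>" if "0 \<le> t" for t using that by (intro antisym) auto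
      then show ?case using elim(3) by (simp add: X_def)
    qed
  qed
  moreover have "particle_minimal_solution M N G \<beta> Z B X L"
    unfolding particle_minimal_solution_def using sol least by simp
  ultimately show ?thesis by (intro exI[of _ X] exI[of _ L]) simp
qed

subsection \<open>Independence of Brownian past and future\<close>

text \<open>Finite-dimensional events: an intersection-stable generator of the sigma-algebra of the
  family, on which independence can be checked.\<close>

definition cylinders :: "'a measure \<Rightarrow> ('i \<Rightarrow> 'a \<Rightarrow> real) \<Rightarrow> 'i set \<Rightarrow> 'a set set" where
  "cylinders M Y T = {{\<omega> \<in> space M. \<forall>s\<in>I. Y s \<omega> \<in> A s} | I A.
     finite I \<and> I \<subseteq> T \<and> (\<forall>s\<in>I. A s \<in> sets borel)}"

lemma Int_stable_cylinders: "Int_stable (cylinders M Y T)"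
proof (rule Int_stableI)
  fix a b assume "a \<in> cylinders M Y T" "b \<in> cylinders M Y T"
  then obtain I A J C where
    I: "finite I" "I \<subseteq> T" "\<forall>s\<in>I. A s \<in> sets borel" "a = {\<omega> \<in> space M. \<forall>s\<in>I. Y s \<omega> \<in> A s}" and
    J: "finite J" "J \<subseteq> T" "\<forall>s\<in>J. C s \<in> sets borel" "b = {\<omega> \<in> space M. \<forall>s\<in>J. Y s \<omega> \<in> C s}"
    unfolding cylinders_def by blast
  \<comment> \<open>\<open>UNIV\<close> imposes nothing at indices that occur in only one of the two
    events.\<close>
  define D where "D s = (if s \<in> I then A s else UNIV) \<inter> (if s \<in> J then C s else UNIV)" for s
  have "a \<inter> b = {\<omega> \<in> space M. \<forall>s\<in>I \<union> J. Y s \<omega> \<in> D s}"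
    unfolding I J D_def by auto
  moreover have "\<forall>s\<in>I \<union> J. D s \<in> sets borel" using I J by (auto simp: D_def)
  ultimately show "a \<inter> b \<in> cylinders M Y T"
    unfolding cylinders_def using I J by (intro CollectI exI[of _ "I \<union> J"] exI[of _ D]) auto
qed

lemma cylinders_sets:
  assumes "\<And>s. s \<in> T \<Longrightarrow> Y s \<in> borel_measurable N" "space N = space M"
  shows "cylinders M Y T \<subseteq> sets N"
proof
  fix a assume "a \<in> cylinders M Y T"
  then obtain I A where I: "finite I" "I \<subseteq> T" "\<forall>s\<in>I. A s \<in> sets borel"
      "a = {\<omega> \<in> space M. \<forall>s\<in>I. Y s \<omega> \<in> A s}"
    unfolding cylinders_def by blast
  have "{\<omega> \<in> space N. \<forall>s\<in>I. Y s \<omega> \<in> A s} \<in> sets N"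
  proof (rule sets.sets_Collect_finite_All[OF _ I(1)])
    fix s assume "s \<in> I"
    then show "{\<omega> \<in> space N. Y s \<omega> \<in> A s} \<in> sets N"
      using assms(1)[of s] I measurable_sets[of "Y s" N borel "A s"] by (auto simp: vimage_def Int_def conj_commute)
  qed
  then show "a \<in> sets N" using I assms by simp
qed

lemma cylinders_basic:
  assumes "s \<in> T" "A \<in> sets borel" shows "Y s -` A \<inter> space M \<in> cylinders M Y T"
  unfolding cylinders_def using assms
  by (intro CollectI exI[of _ "{s}"] exI[of _ "\<lambda>_. A"]) auto

text \<open>\<open>std_BM\<close> states independence of increments along strictly increasing times,
  while cylinder events involve unordered finite sets. The equivalence turns comparisons of times
  into comparisons of indices.\<close>

lemma finite_strict_enumeration:
  fixes S :: "real set"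
  assumes "finite S" "S \<noteq> {}"
  shows "\<exists>(ts :: nat \<Rightarrow> real) n. S = ts ` {..n} \<and> (\<forall>i\<le>n. \<forall>j\<le>n. ts i < ts j \<longleftrightarrow> i < j)"
proof -
  define xs where "xs = sorted_list_of_set S"
  define n where "n = length xs - 1"
  have len: "length xs = Suc n" using assms by (auto simp: n_def xs_def Suc_diff_1 card_gt_0_iff)
  have "S = set xs" using assms by (simp add: xs_def)
  also have "\<dots> = (\<lambda>k. xs ! k) ` {..n}" by (auto simp: set_conv_nth len less_Suc_eq_le)
  finally have "S = (\<lambda>k. xs ! k) ` {..n}" .
  moreover have lt: "xs ! i < xs ! j" if "i < j" "j \<le> n" for i j
    using that sorted_wrt_nth_less[of "(<)" xs i j] len by (simp add: xs_def)
  have "xs ! i < xs ! j \<longleftrightarrow> i < j" if "i \<le> n" "j \<le> n" for i j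
    using lt[of i j] lt[of j i] that by (metis less_irrefl less_asym linorder_neqE_nat)
  ultimately show ?thesis by blast
qed

locale driver = prob_space M for M :: "'a measure" +
  fixes Z :: "'a \<Rightarrow> real" and B :: "real \<Rightarrow> 'a \<Rightarrow> real"
  assumes setting: "MV_setting M Z B"
begin

lemma Z_measurable [measurable]: "Z \<in> borel_measurable M"
  using setting by (simp add: MV_setting_def)

lemma BM: "std_BM M B"
  using setting by (simp add: MV_setting_def)

lemma B_measurable: "0 \<le> t \<Longrightarrow> B t \<in> borel_measurable M"
  using BM by (simp add: std_BM_def)

lemma B_0: "\<omega> \<in> space M \<Longrightarrow> B 0 \<omega> = 0"
  using BM by (simp add: std_BM_def)

lemma B_continuous: "\<omega> \<in> space M \<Longrightarrow> continuous_on {0..} (\<lambda>t. B t \<omega>)"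
  using BM by (simp add: std_BM_def)

lemma increment_normal:
  "0 \<le> s \<Longrightarrow> s < t \<Longrightarrow> distributed M lborel (\<lambda>\<omega>. B t \<omega> - B s \<omega>)
     (\<lambda>x. ennreal (normal_density 0 (sqrt (t - s)) x))"
  using BM by (simp add: std_BM_def)

lemma increments_indep:
  assumes "0 \<le> ts 0" "\<And>k. k < n \<Longrightarrow> ts k < ts (Suc k)"
  shows "indep_vars (\<lambda>_. borel) (\<lambda>k \<omega>. B (ts (Suc k)) \<omega> - B (ts k) \<omega>) {..<n}"
  using BM assms unfolding std_BM_def by blast

definition incr :: "real \<Rightarrow> real \<Rightarrow> 'a \<Rightarrow> real" where
  "incr t s \<omega> = B s \<omega> - B t \<omega>"

lemma incr_measurable: "0 \<le> t \<Longrightarrow> t \<le> s \<Longrightarrow> incr t s \<in> borel_measurable M"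
  unfolding incr_def[abs_def] using B_measurable[of t] B_measurable[of s] by measurable

text \<open>On the ordered grid of all times involved, with \<open>ts m = t\<close>, a past value is
  a sum of increments with index below \<open>m\<close>, and a future increment is a sum of those
  from \<open>m\<close> on. Disjoint blocks of independent increments are independent.\<close>

lemma cylinders_indep:
  assumes t: "0 \<le> t"
  shows "indep_set (cylinders M B {0..t}) (cylinders M (incr t) {t..})"
proof (rule indep_setI)
  show "cylinders M B {0..t} \<subseteq> events" by (rule cylinders_sets) (auto intro: B_measurable)
  show "cylinders M (incr t) {t..} \<subseteq> events" by (rule cylinders_sets) (use t in \<open>auto intro: incr_measurable\<close>)
  fix a b assume "a \<in> cylinders M B {0..t}" "b \<in> cylinders M (incr t) {t..}"
  then obtain I A J C where
    I: "finite I" "I \<subseteq> {0..t}" "\<forall>s\<in>I. A s \<in> sets borel" "a = {\<omega> \<in> space M. \<forall>s\<in>I. B s \<omega> \<in> A s}" and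
    J: "finite J" "J \<subseteq> {t..}" "\<forall>s\<in>J. C s \<in> sets borel" "b = {\<omega> \<in> space M. \<forall>s\<in>J. incr t s \<omega> \<in> C s}"
    unfolding cylinders_def by blast
  \<comment> \<open>\<open>0\<close> makes every past value a telescoping sum starting from
    \<open>B 0 = 0\<close>; \<open>t\<close> lets the grid split exactly between past and
    future.\<close>
  define S where "S = insert 0 (insert t (I \<union> J))"
  have "finite S" "S \<noteq> {}" using I J by (auto simp: S_def)
  then obtain ts :: "nat \<Rightarrow> real" and n where S: "S = ts ` {..n}" and ts: "\<And>i j. i \<le> n \<Longrightarrow> j \<le> n \<Longrightarrow> ts i < ts j \<longleftrightarrow> i < j"
    using finite_strict_enumeration by metis
  have Snn: "S \<subseteq> {0..}" using I J t by (auto simp: S_def)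
  have ts0: "ts 0 = 0"
  proof -
    have "0 \<in> ts ` {..n}" unfolding S[symmetric] by (simp add: S_def)
    then obtain i where "i \<le> n" "ts i = 0" by auto
    moreover have "0 \<le> ts 0" using Snn by (auto simp: S)
    ultimately show ?thesis using ts[of 0 i] by (cases "i = 0") auto
  qed
  have "\<forall>s\<in>S. \<exists>j\<le>n. ts j = s" unfolding S by auto
  then obtain ix where ix: "\<And>s. s \<in> S \<Longrightarrow> ix s \<le> n" "\<And>s. s \<in> S \<Longrightarrow> ts (ix s) = s" by metis
  define m where "m = ix t"
  have m: "m \<le> n" "ts m = t" using ix by (auto simp: m_def S_def)
  have ixI: "ix s \<le> m" if "s \<in> I" for s
    using that I ts[of m "ix s"] ix[of s] m by (auto simp: S_def not_less[symmetric])
  have ixJ: "m \<le> ix s" if "s \<in> J" for s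
    using that J ts[of "ix s" m] ix[of s] m by (auto simp: S_def not_less[symmetric])
  define \<xi> where "\<xi> k \<omega> = B (ts (Suc k)) \<omega> - B (ts k) \<omega>" for k \<omega>
  have "indep_vars (\<lambda>_. borel) \<xi> {..<n}"
    unfolding \<xi>_def using ts ts0 by (intro increments_indep) auto
  then have indep: "indep_var (PiM {..<m} (\<lambda>_. borel)) (\<lambda>\<omega>. restrict (\<lambda>i. \<xi> i \<omega>) {..<m})
      (PiM {m..<n} (\<lambda>_. borel)) (\<lambda>\<omega>. restrict (\<lambda>i. \<xi> i \<omega>) {m..<n})"
    using m by (intro indep_var_restrict) auto
  define A' where "A' = {x \<in> space (PiM {..<m} (\<lambda>_. borel)). \<forall>s\<in>I. (\<Sum>k<ix s. x k) \<in> A s}"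
  define C' where "C' = {x \<in> space (PiM {m..<n} (\<lambda>_. borel)). \<forall>s\<in>J. (\<Sum>k=m..<ix s. x k) \<in> C s}"
  have A': "A' \<in> sets (PiM {..<m} (\<lambda>_. borel))"
    unfolding A'_def
  proof (rule sets.sets_Collect_finite_All[OF _ I(1)])
    fix s assume "s \<in> I"
    then have "(\<lambda>x. \<Sum>k<ix s. x k) \<in> borel_measurable (PiM {..<m} (\<lambda>_. borel :: real measure))"
      using ixI by (intro borel_measurable_sum measurable_component_singleton) force
    then show "{x \<in> space (PiM {..<m} (\<lambda>_. borel)). (\<Sum>k<ix s. x k) \<in> A s} \<in> sets (PiM {..<m} (\<lambda>_. borel))"
      using I \<open>s \<in> I\<close> by (auto intro: measurable_sets_Collect)
  qed
  have C': "C' \<in> sets (PiM {m..<n} (\<lambda>_. borel))"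
    unfolding C'_def
  proof (rule sets.sets_Collect_finite_All[OF _ J(1)])
    fix s assume "s \<in> J"
    then have "ix s \<le> n" using ix by (auto simp: S_def)
    then have "(\<lambda>x. \<Sum>k=m..<ix s. x k) \<in> borel_measurable (PiM {m..<n} (\<lambda>_. borel :: real measure))"
      by (intro borel_measurable_sum measurable_component_singleton) force
    then show "{x \<in> space (PiM {m..<n} (\<lambda>_. borel)). (\<Sum>k=m..<ix s. x k) \<in> C s} \<in> sets (PiM {m..<n} (\<lambda>_. borel))"
      using J \<open>s \<in> J\<close> by (auto intro: measurable_sets_Collect)
  qed
  have sumI: "(\<Sum>k<ix s. restrict (\<lambda>i. \<xi> i \<omega>) {..<m} k) = B s \<omega>" if "s \<in> I" "\<omega> \<in> space M" for s \<omega>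
  proof -
    have "(\<Sum>k<ix s. restrict (\<lambda>i. \<xi> i \<omega>) {..<m} k) = (\<Sum>k<ix s. B (ts (Suc k)) \<omega> - B (ts k) \<omega>)"
      using ixI[OF that(1)] by (intro sum.cong) (auto simp: \<xi>_def)
    also have "\<dots> = B s \<omega>" using that ix(2)[of s] ts0 B_0 sum_lessThan_telescope[of "\<lambda>k. B (ts k) \<omega>" "ix s"]
      by (simp add: S_def)
    finally show ?thesis .
  qed
  have sumJ: "(\<Sum>k=m..<ix s. restrict (\<lambda>i. \<xi> i \<omega>) {m..<n} k) = incr t s \<omega>" if "s \<in> J" "\<omega> \<in> space M" for s \<omega>
  proof -
    have "ix s \<le> n" using ix that by (auto simp: S_def)
    then have "(\<Sum>k=m..<ix s. restrict (\<lambda>i. \<xi> i \<omega>) {m..<n} k) = (\<Sum>k=m..<ix s. B (ts (Suc k)) \<omega> - B (ts k) \<omega>)"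
      by (intro sum.cong) (auto simp: \<xi>_def)
    also have "\<dots> = incr t s \<omega>"
      using that ix(2)[of s] m sum_Suc_diff'[OF ixJ[OF that(1)], of "\<lambda>k. B (ts k) \<omega>"]
      by (simp add: S_def incr_def)
    finally show ?thesis .
  qed
  have a: "a = (\<lambda>\<omega>. restrict (\<lambda>i. \<xi> i \<omega>) {..<m}) -` A' \<inter> space M"
    unfolding I(4) A'_def using sumI by (auto simp: space_PiM)
  have b: "b = (\<lambda>\<omega>. restrict (\<lambda>i. \<xi> i \<omega>) {m..<n}) -` C' \<inter> space M"
    unfolding J(4) C'_def using sumJ by (auto simp: space_PiM)
  have "a \<inter> b = (\<lambda>\<omega>. (restrict (\<lambda>i. \<xi> i \<omega>) {..<m}, restrict (\<lambda>i. \<xi> i \<omega>) {m..<n})) -` (A' \<times> C') \<inter> space M"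
    unfolding a b by auto
  then show "prob (a \<inter> b) = prob a * prob b"
    using indep_varD[OF indep A' C'] by (simp add: a b)
qed

text \<open>A one-particle filtration, so the measurability lemmas of the particle system apply to
  \<open>Z\<close> and \<open>B\<close>.\<close>

abbreviation past :: "real \<Rightarrow> 'a measure" where
  "past t \<equiv> particle_filtration M (Suc 0) (\<lambda>_. Z) (\<lambda>_. B) t"

definition future :: "real \<Rightarrow> 'a measure" where
  "future t = sigma (space M) (cylinders M (incr t) {t..})"

lemma space_future [simp]: "space (future t) = space M"
  unfolding future_def by (rule space_measure_of) (auto simp: cylinders_def)

lemma sets_future: "sets (future t) = sigma_sets (space M) (cylinders M (incr t) {t..})"
  unfolding future_def by (rule sets_measure_of) (auto simp: cylinders_def)

lemma incr_future: "t \<le> s \<Longrightarrow> incr t s \<in> borel_measurable (future t)"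
  by (rule measurableI) (auto simp: sets_future intro!: sigma_sets.Basic cylinders_basic)

lemma incr_past: "0 \<le> t \<Longrightarrow> t \<le> s \<Longrightarrow> s \<le> u \<Longrightarrow> incr t s \<in> borel_measurable (past u)"
  unfolding incr_def[abs_def]
  by (intro borel_measurable_diff process_measurable_filtration[where B="\<lambda>_. B" and i=1, simplified]) auto

lemma past_events: "sets (past t) \<subseteq> events"
  unfolding sets_particle_filtration
  by (intro sets.sigma_sets_subset) (auto intro!: measurable_sets B_measurable Z_measurable)

lemma future_events: "0 \<le> t \<Longrightarrow> sets (future t) \<subseteq> events"
  unfolding sets_future
  by (intro sets.sigma_sets_subset cylinders_sets) (auto intro!: incr_measurable)

text \<open>\<open>Z\<close> is independent of the whole Brownian path, and the path up to
  \<open>t\<close> of the later increments. Splitting these off one after the other handles the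
  events \<open>D \<inter> F\<close> in \<open>\<D>\<close>, an intersection-stable family whose
  sigma-algebra contains the past.\<close>

lemma prob_past_future:
  assumes t: "0 \<le> t" and E: "E \<in> sets (past t)" and A: "A \<in> sets (future t)"
  shows "prob (E \<inter> A) = prob E * prob A"
proof -
  let ?Z = "sets (vimage_algebra (space M) Z borel)"
  let ?P = "vimage_algebra (space M) (path B) path_space"
  let ?c1 = "cylinders M B {0..t}" and ?c2 = "cylinders M (incr t) {t..}"
  have indep_ZB: "indep_set ?Z (sets ?P)" using setting by (simp add: MV_setting_def)
  have indep_B: "indep_set (sigma_sets (space M) ?c1) (sigma_sets (space M) ?c2)"
    by (intro indep_set_sigma_sets cylinders_indep t Int_stable_cylinders)
  have B_P: "B s \<in> borel_measurable ?P" if "0 \<le> s" for s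
  proof -
    have "path B \<in> measurable ?P path_space"
      by (rule measurable_vimage_algebra1) (auto simp: path_def path_space_def space_PiM)
    moreover have "(\<lambda>x. x s) \<in> measurable path_space borel"
      using that unfolding path_space_def by (intro measurable_component_singleton) simp
    ultimately have "(\<lambda>\<omega>. path B \<omega> s) \<in> borel_measurable ?P" by (rule measurable_compose)
    then show ?thesis using that by (simp add: path_def)
  qed
  have c1: "sigma_sets (space M) ?c1 \<subseteq> sets ?P"
    using cylinders_sets[of "{0..t}" B ?P M] B_P sets.sigma_sets_subset[of ?c1 ?P] by simp
  have "incr t s \<in> borel_measurable ?P" if "t \<le> s" for s
    unfolding incr_def[abs_def] using that t by (intro borel_measurable_diff B_P) auto
  then have c2: "?c2 \<subseteq> sets ?P" by (intro cylinders_sets) auto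
  define \<D> where "\<D> = {D \<inter> F | D F. D \<in> ?Z \<and> F \<in> sigma_sets (space M) ?c1}"
  have "indep_set \<D> ?c2"
  proof (rule indep_setI)
    show "\<D> \<subseteq> events"
      using indep_setD_ev1[OF indep_ZB] indep_setD_ev1[OF indep_B] by (auto simp: \<D>_def)
    show "?c2 \<subseteq> events" using cylinders_indep[OF t] by (rule indep_setD_ev2)
    fix a b assume "a \<in> \<D>" and b: "b \<in> ?c2"
    then obtain D F where a: "a = D \<inter> F" "D \<in> ?Z" "F \<in> sigma_sets (space M) ?c1" by (auto simp: \<D>_def)
    have "prob (a \<inter> b) = prob (D \<inter> (F \<inter> b))" by (simp add: a Int_assoc)
    also have "\<dots> = prob D * prob (F \<inter> b)" using a b c1 c2 by (intro indep_setD[OF indep_ZB]) auto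
    also have "prob (F \<inter> b) = prob F * prob b" using a b by (intro indep_setD[OF indep_B]) auto
    also have "prob D * (prob F * prob b) = prob (D \<inter> F) * prob b"
      using indep_setD[OF indep_ZB, of D F] a c1 by (simp add: subset_iff)
    finally show "prob (a \<inter> b) = prob a * prob b" by (simp add: a)
  qed
  moreover have "Int_stable \<D>"
  proof (rule Int_stableI)
    fix a b assume "a \<in> \<D>" "b \<in> \<D>"
    then obtain D F D' F' where *: "a = D \<inter> F" "D \<in> ?Z" "F \<in> sigma_sets (space M) ?c1"
        "b = D' \<inter> F'" "D' \<in> ?Z" "F' \<in> sigma_sets (space M) ?c1"
      by (auto simp: \<D>_def)
    interpret c1: sigma_algebra "space M" "sigma_sets (space M) ?c1"
      by (rule sigma_algebra_sigma_sets) (auto simp: cylinders_def)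
    have "a \<inter> b = (D \<inter> D') \<inter> (F \<inter> F')" using * by auto
    then show "a \<inter> b \<in> \<D>" using * unfolding \<D>_def by blast
  qed
  ultimately have indep: "indep_set (sigma_sets (space M) \<D>) (sigma_sets (space M) ?c2)"
    by (intro indep_set_sigma_sets Int_stable_cylinders)
  have "sets (past t) \<subseteq> sigma_sets (space M) \<D>"
    unfolding sets_particle_filtration
  proof (rule sigma_sets_mono, safe)
    fix i :: nat and A :: "real set" assume "A \<in> sets borel"
    then have "Z -` A \<inter> space M \<in> ?Z" by (intro in_vimage_algebra)
    moreover have "space M \<in> sigma_sets (space M) ?c1" by (rule sigma_sets_top)
    ultimately have "(Z -` A \<inter> space M) \<inter> space M \<in> \<D>" unfolding \<D>_def by blast
    then show "Z -` A \<inter> space M \<in> sigma_sets (space M) \<D>" by (intro sigma_sets.Basic) (simp add: Int_assoc)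
  next
    fix i :: nat and s and A :: "real set" assume "s \<in> {0..t}" "A \<in> sets borel"
    then have "B s -` A \<inter> space M \<in> sigma_sets (space M) ?c1" by (intro sigma_sets.Basic cylinders_basic)
    moreover have "space M \<in> ?Z" using sets.top[of "vimage_algebra (space M) Z borel"] by simp
    ultimately have "space M \<inter> (B s -` A \<inter> space M) \<in> \<D>" unfolding \<D>_def by blast
    then show "B s -` A \<inter> space M \<in> sigma_sets (space M) \<D>" by (intro sigma_sets.Basic) (simp add: Int_absorb1 Int_commute)
  qed
  then show ?thesis
    using E A unfolding sets_future by (intro indep_setD[OF indep]) auto
qed

end

subsection \<open>Brownian paths that escape\<close>

lemma barrier_const: "barrier (\<lambda>_. k)"
  by unfold_locales (auto intro: mono_onI)

lemma std_normal_tail_pos: "0 < measure (density lborel std_normal_density) {1..}"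
proof -
  interpret N: prob_space "density lborel std_normal_density"
    by (rule prob_space_normal_density) simp
  have "measure (density lborel std_normal_density) {1..} \<noteq> 0"
  proof
    assume "measure (density lborel std_normal_density) {1..} = 0"
    then have "{1..} \<in> null_sets (density lborel std_normal_density)"
      by (intro null_setsI) (auto simp: N.emeasure_eq_measure)
    then have "AE x in lborel. x \<in> {1..} \<longrightarrow> ennreal (std_normal_density x) = 0"
      by (subst (asm) null_sets_density_iff) auto
    moreover have "ennreal (std_normal_density x) \<noteq> 0" for x
      using normal_density_pos[of 1 0 x] by simp
    ultimately have "AE x in lborel. x \<notin> {1..2::real}" by (auto elim!: eventually_mono)
    then have "emeasure lborel {1..2::real} = 0"
      by (subst (asm) AE_iff_measurable[of "{1..2}"]) auto
    then show False by simp
  qed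
  then show ?thesis by (simp add: zero_less_measure_iff)
qed

text \<open>Completing the square: the tilted density is the normal density with mean
  \<open>- 2 * c * \<sigma>\<^sup>2\<close>. The exponent \<open>- 2 * c\<close> is the one that
  exactly balances a drift \<open>c\<close>.\<close>

lemma nn_integral_normal_exp:
  assumes "0 < \<sigma>"
  shows "(\<integral>\<^sup>+x. ennreal (normal_density 0 \<sigma> x) * ennreal (exp (- 2 * c * (x + c * \<sigma>\<^sup>2))) \<partial>lborel) = 1"
proof -
  have "- (x - 0)\<^sup>2 / (2 * \<sigma>\<^sup>2) + - 2 * c * (x + c * \<sigma>\<^sup>2) = - (x - (- 2 * c * \<sigma>\<^sup>2))\<^sup>2 / (2 * \<sigma>\<^sup>2)" for x
    using assms by (simp add: field_simps power2_eq_square)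
  then have "normal_density 0 \<sigma> x * exp (- 2 * c * (x + c * \<sigma>\<^sup>2)) = normal_density (- 2 * c * \<sigma>\<^sup>2) \<sigma> x" for x
    unfolding normal_density_def by (simp only: mult.assoc exp_add[symmetric])
  then have "(\<integral>\<^sup>+x. ennreal (normal_density 0 \<sigma> x) * ennreal (exp (- 2 * c * (x + c * \<sigma>\<^sup>2))) \<partial>lborel) =
      (\<integral>\<^sup>+x. ennreal (normal_density (- 2 * c * \<sigma>\<^sup>2) \<sigma> x) \<partial>lborel)"
    by (simp add: ennreal_mult''[symmetric])
  also have "\<dots> = 1"
    using assms by (simp add: nn_integral_eq_integral normal_density_nonneg)
  finally show ?thesis .
qed

lemma measurable_finer:
  assumes "f \<in> measurable A N" "sets A \<subseteq> sets M" "space A = space M"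
  shows "f \<in> measurable M N"
  using assms by (auto simp: measurable_def)

context driver begin

lemma incr_self [simp]: "incr t t \<omega> = 0"
  by (simp add: incr_def)

lemma incr_add: "incr r s \<omega> + incr s t \<omega> = incr r t \<omega>"
  by (simp add: incr_def)

lemma incr_continuous:
  assumes "\<omega> \<in> space M" "0 \<le> t" shows "continuous_on {0..} (\<lambda>s. incr t (t + s) \<omega>)"
  unfolding incr_def
  by (intro continuous_intros continuous_on_compose2[OF B_continuous[OF assms(1)]]) (use assms in auto)

lemma nn_integral_past_future:
  fixes f g :: "'a \<Rightarrow> ennreal"
  assumes t: "0 \<le> t" and f: "f \<in> borel_measurable (past t)" and g: "g \<in> borel_measurable (future t)"
  shows "(\<integral>\<^sup>+\<omega>. f \<omega> * g \<omega> \<partial>M) = (\<integral>\<^sup>+\<omega>. f \<omega> \<partial>M) * (\<integral>\<^sup>+\<omega>. g \<omega> \<partial>M)"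
proof -
  have f_sets: "sigma_sets (space M) {f -` A \<inter> space M | A. A \<in> sets borel} \<subseteq> sets (past t)"
    using sets.sigma_sets_subset[of "{f -` A \<inter> space M | A. A \<in> sets borel}" "past t"]
      measurable_sets[OF f] by auto
  have g_sets: "sigma_sets (space M) {g -` A \<inter> space M | A. A \<in> sets borel} \<subseteq> sets (future t)"
    using sets.sigma_sets_subset[of "{g -` A \<inter> space M | A. A \<in> sets borel}" "future t"]
      measurable_sets[OF g] by auto
  have "indep_var borel f borel g"
    unfolding indep_var_eq
  proof (intro conjI indep_setI)
    show "random_variable borel f"
      using f past_events by (rule measurable_finer) simp
    show "random_variable borel g"
      using g future_events[OF t] by (rule measurable_finer) simp
    show "sigma_sets (space M) {f -` A \<inter> space M | A. A \<in> sets borel} \<subseteq> events"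
      using f_sets past_events by (rule subset_trans)
    show "sigma_sets (space M) {g -` A \<inter> space M | A. A \<in> sets borel} \<subseteq> events"
      using g_sets future_events[OF t] by (rule subset_trans)
  qed (use f_sets g_sets in \<open>blast intro: prob_past_future[OF t]\<close>)
  moreover have "case_bool borel borel = (\<lambda>_. borel :: ennreal measure)"
    by (auto split: bool.split)
  ultimately have "indep_vars (\<lambda>_. borel) (case_bool f g) UNIV"
    by (simp add: indep_var_def)
  from indep_vars_nn_integral[OF _ this] show ?thesis by (simp add: UNIV_bool mult.commute)
qed

lemma exponential_increment:
  assumes "0 \<le> t" "0 < h"
  shows "(\<integral>\<^sup>+\<omega>. ennreal (exp (- 2 * c * (incr t (t + h) \<omega> + c * h))) \<partial>M) = 1"
  using distributed_nn_integral[OF increment_normal[of t "t + h"],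
      of "\<lambda>x. ennreal (exp (- 2 * c * (x + c * h)))"]
    nn_integral_normal_exp[of "sqrt h" c] assms by (simp add: incr_def)

text \<open>
  Doob's maximal inequality for the exponential martingale of the drifted Brownian motion, read
  off along a grid of mesh \<open>h\<close>.
\<close>

lemma grid_maximal_inequality:
  assumes t: "0 \<le> t" and c: "0 \<le> c" and a: "0 \<le> a" and h: "0 < h"
  shows "prob {\<omega> \<in> space M. \<exists>j\<le>k. incr t (t + real j * h) \<omega> + c * (real j * h) < - a} \<le> exp (- 2 * c * a)"
proof -
  define W where "W j \<omega> = incr t (t + real j * h) \<omega> + c * (real j * h)" for j \<omega>
  define D where "D k \<omega> \<longleftrightarrow> (\<exists>j\<le>k. W j \<omega> < - a)" for k \<omega>
  \<comment> \<open>The exponential martingale of \<open>W\<close>, stopped at the first dip, with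
    its value there cut down to \<open>exp (2 * c * a)\<close>; the cut can only lower
    expectations.\<close>
  define f where "f k \<omega> = (if D k \<omega> then exp (2 * c * a) else exp (- 2 * c * W k \<omega>))" for k \<omega>
  have W_past: "W j \<in> borel_measurable (past (t + real k * h))" if "j \<le> k" for j k
    unfolding W_def[abs_def] using that t h
    by (intro borel_measurable_add borel_measurable_const incr_past) (auto intro!: mult_right_mono)
  have D_past: "{\<omega> \<in> space (past (t + real k * h)). D k \<omega>} \<in> sets (past (t + real k * h))" for k
  proof -
    have "{\<omega> \<in> space (past (t + real k * h)). \<exists>j\<in>{..k}. W j \<omega> < - a} \<in> sets (past (t + real k * h))"
    proof (intro sets.sets_Collect_countable_Ex')
      fix j assume "j \<in> {..k}"
      then have [measurable]: "W j \<in> borel_measurable (past (t + real k * h))" by (simp add: W_past)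
      show "{\<omega> \<in> space (past (t + real k * h)). W j \<omega> < - a} \<in> sets (past (t + real k * h))"
        by measurable
    qed simp
    then show ?thesis by (simp only: D_def Bex_def atMost_iff)
  qed
  have mart: "(\<integral>\<^sup>+\<omega>. ennreal (f k \<omega>) \<partial>M) \<le> 1" for k
  proof (induction k)
    case 0
    have "f 0 \<omega> = 1" for \<omega> using a by (simp add: f_def D_def W_def)
    then show ?case by (simp add: emeasure_space_1)
  next
    case (Suc k)
    define r where "r = t + real k * h"
    \<comment> \<open>Stopped paths contribute \<open>u\<close>; running ones contribute
      \<open>v\<close>, multiplied by the factor \<open>\<xi>\<close> of mean \<open>1\<close> that
      is independent of the past.\<close>
    define \<xi> where "\<xi> \<omega> = ennreal (exp (- 2 * c * (incr r (r + h) \<omega> + c * h)))" for \<omega>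
    define u where "u \<omega> = ennreal (if D k \<omega> then exp (2 * c * a) else 0)" for \<omega>
    define v where "v \<omega> = ennreal (if D k \<omega> then 0 else exp (- 2 * c * W k \<omega>))" for \<omega>
    have r: "0 \<le> r" using t h by (simp add: r_def)
    have [measurable]: "W k \<in> borel_measurable (past r)" "Measurable.pred (past r) (D k)"
      using W_past[of k k] D_past[of k] by (auto simp: r_def pred_def)
    have u: "u \<in> borel_measurable (past r)" unfolding u_def[abs_def] by measurable
    have v: "v \<in> borel_measurable (past r)" unfolding v_def[abs_def] by measurable
    have past_M: "x \<in> borel_measurable M" if "x \<in> borel_measurable (past r)" for x :: "'a \<Rightarrow> ennreal"
      using that past_events by (rule measurable_finer) simp
    have [measurable]: "incr r (r + h) \<in> borel_measurable (future r)" using h by (intro incr_future) simp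
    have \<xi>: "\<xi> \<in> borel_measurable (future r)" unfolding \<xi>_def[abs_def] by measurable
    have \<xi>_M: "\<xi> \<in> borel_measurable M"
      using \<xi> future_events[OF r] by (rule measurable_finer) simp
    have "ennreal (f (Suc k) \<omega>) \<le> u \<omega> + v \<omega> * \<xi> \<omega>" for \<omega>
    proof (cases "D k \<omega>")
      case True
      then have "D (Suc k) \<omega>" by (auto simp: D_def intro: le_SucI)
      then show ?thesis using True by (simp add: f_def u_def v_def)
    next
      case False
      have "r + h = t + real (Suc k) * h" by (simp add: r_def algebra_simps)
      then have "W (Suc k) \<omega> = W k \<omega> + (incr r (r + h) \<omega> + c * h)"
        using incr_add[of t r \<omega> "r + h"] by (simp add: W_def r_def algebra_simps)
      then have "exp (- 2 * c * W (Suc k) \<omega>) = exp (- 2 * c * W k \<omega>) * exp (- 2 * c * (incr r (r + h) \<omega> + c * h))"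
        by (simp add: exp_add[symmetric] algebra_simps)
      moreover have "f (Suc k) \<omega> \<le> exp (- 2 * c * W (Suc k) \<omega>)"
      proof (cases "D (Suc k) \<omega>")
        case True
        with False have "W (Suc k) \<omega> < - a" by (auto simp: D_def le_Suc_eq)
        then have "2 * c * a \<le> 2 * c * - W (Suc k) \<omega>" using c by (intro mult_left_mono) auto
        then show ?thesis
          unfolding f_def if_P[OF True] exp_le_cancel_iff by (simp only: mult_minus_right mult_minus_left)
      qed (simp add: f_def)
      ultimately show ?thesis
        using False by (simp add: u_def v_def \<xi>_def ennreal_mult''[symmetric] ennreal_leI)
    qed
    then have "(\<integral>\<^sup>+\<omega>. ennreal (f (Suc k) \<omega>) \<partial>M) \<le> (\<integral>\<^sup>+\<omega>. u \<omega> + v \<omega> * \<xi> \<omega> \<partial>M)"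
      by (intro nn_integral_mono)
    also have "\<dots> = (\<integral>\<^sup>+\<omega>. u \<omega> \<partial>M) + (\<integral>\<^sup>+\<omega>. v \<omega> * \<xi> \<omega> \<partial>M)"
      by (intro nn_integral_add past_M u borel_measurable_times_ennreal v \<xi>_M)
    also have "(\<integral>\<^sup>+\<omega>. v \<omega> * \<xi> \<omega> \<partial>M) = (\<integral>\<^sup>+\<omega>. v \<omega> \<partial>M)"
      using nn_integral_past_future[OF r v \<xi>] exponential_increment[OF r h, of c] by (simp add: \<xi>_def)
    also have "(\<integral>\<^sup>+\<omega>. u \<omega> \<partial>M) + (\<integral>\<^sup>+\<omega>. v \<omega> \<partial>M) = (\<integral>\<^sup>+\<omega>. u \<omega> + v \<omega> \<partial>M)"
      by (intro nn_integral_add[symmetric] past_M u v)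
    also have "\<dots> = (\<integral>\<^sup>+\<omega>. ennreal (f k \<omega>) \<partial>M)"
      by (intro nn_integral_cong) (simp add: u_def v_def f_def)
    also have "\<dots> \<le> 1" by (rule Suc.IH)
    finally show ?case .
  qed
  let ?D = "{\<omega> \<in> space M. D k \<omega>}"
  have D: "?D \<in> events" using D_past[of k] past_events by auto
  have "ennreal (exp (2 * c * a) * prob ?D) = (\<integral>\<^sup>+\<omega>. ennreal (exp (2 * c * a)) * indicator ?D \<omega> \<partial>M)"
    using D by (simp add: nn_integral_cmult_indicator emeasure_eq_measure ennreal_mult)
  also have "\<dots> \<le> (\<integral>\<^sup>+\<omega>. ennreal (f k \<omega>) \<partial>M)"
    by (intro nn_integral_mono) (auto simp: f_def indicator_def)
  also have "\<dots> \<le> 1" by (rule mart)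
  finally have "exp (2 * c * a) * prob ?D \<le> 1" by simp
  then show ?thesis
    unfolding D_def W_def by (simp add: exp_minus field_simps)
qed

text \<open>The strict inequality is an open condition on a continuous path, so dyadic grids of mesh
  \<open>1 / 2 ^ m\<close> detect it. With \<open>4 ^ m\<close> steps such a grid extends to time
  \<open>2 ^ m\<close> and eventually covers every \<open>s\<close>; halving the mesh keeps the old
  grid points, so the events increase and the bound survives the limit.\<close>

lemma dip_event:
  assumes t: "0 \<le> t" and c: "0 \<le> c" and a: "0 \<le> a"
  shows dip_future: "{\<omega> \<in> space M. \<exists>s\<ge>0. incr t (t + s) \<omega> + c * s < - a} \<in> sets (future t)" (is "?U \<in> _")
    and prob_dip: "prob {\<omega> \<in> space M. \<exists>s\<ge>0. incr t (t + s) \<omega> + c * s < - a} \<le> exp (- 2 * c * a)"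
proof -
  define h where "h m = (1 / 2 ^ m :: real)" for m :: nat
  define U where "U m = {\<omega> \<in> space M. \<exists>j\<le>(4::nat)^m. incr t (t + real j * h m) \<omega> + c * (real j * h m) < - a}" for m
  have U_future: "U m \<in> sets (future t)" for m
  proof -
    have "{\<omega> \<in> space (future t). incr t (t + real j * h m) \<omega> + c * (real j * h m) < - a} \<in> sets (future t)" for j
    proof -
      have [measurable]: "incr t (t + real j * h m) \<in> borel_measurable (future t)"
        by (rule incr_future) (simp add: h_def)
      show ?thesis by measurable
    qed
    then show ?thesis
      unfolding U_def using sets.sets_Collect_countable_Ex'[of "{..(4::nat)^m}" "future t"]
      by (simp only: Bex_def atMost_iff space_future finite_atMost countable_finite)
  qed
  have U_sub: "U m \<subseteq> ?U" for m
    unfolding U_def by (auto simp: h_def intro!: exI[of _ "real _ * (1 / 2 ^ m)"])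
  have "?U \<subseteq> (\<Union>m. U m)"
  proof
    fix \<omega> assume "\<omega> \<in> ?U"
    then obtain s where \<omega>: "\<omega> \<in> space M" and s: "0 \<le> s" "incr t (t + s) \<omega> + c * s < - a" by auto
    define j where "j m = nat \<lfloor>s * 2 ^ m\<rfloor>" for m :: nat
    have j: "real (j m) \<le> s * 2 ^ m" "s * 2 ^ m < real (j m) + 1" for m
      using s by (auto simp: j_def)
    have "(\<lambda>m. real (j m) * h m) \<longlonglongrightarrow> s"
    proof (rule real_tendsto_sandwich)
      show "\<forall>\<^sub>F m in sequentially. s - h m \<le> real (j m) * h m"
      proof (intro always_eventually allI)
        fix m
        have "s \<le> (real (j m) + 1) * h m"
          using j(2)[of m] by (simp add: h_def pos_le_divide_eq less_imp_le)
        then show "s - h m \<le> real (j m) * h m" by (simp add: algebra_simps)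
      qed
      show "\<forall>\<^sub>F m in sequentially. real (j m) * h m \<le> s"
        using j(1) by (intro always_eventually allI) (simp add: h_def pos_divide_le_eq)
      have "h \<longlonglongrightarrow> 0"
        using LIMSEQ_power_zero[of "1/2::real"] by (simp add: h_def[abs_def] power_one_over)
      then show "(\<lambda>m. s - h m) \<longlonglongrightarrow> s" using tendsto_diff[OF tendsto_const, of h 0 sequentially s] by simp
    qed simp
    moreover have "continuous_on {0..} (\<lambda>s. incr t (t + s) \<omega> + c * s)"
      by (intro continuous_intros incr_continuous \<omega> t)
    ultimately have "(\<lambda>m. incr t (t + real (j m) * h m) \<omega> + c * (real (j m) * h m)) \<longlonglongrightarrow> incr t (t + s) \<omega> + c * s"
      using s by (intro continuous_on_tendsto_compose[where f="\<lambda>s. incr t (t + s) \<omega> + c * s"]) (auto simp: h_def)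
    then have "\<forall>\<^sub>F m in sequentially. incr t (t + real (j m) * h m) \<omega> + c * (real (j m) * h m) < - a"
      using s by (intro order_tendstoD)
    moreover have "\<forall>\<^sub>F m in sequentially. s \<le> 2 ^ m"
    proof -
      obtain m0 where "s < 2 ^ m0" using real_arch_pow[of 2 s] by auto
      then have "s \<le> 2 ^ m" if "m0 \<le> m" for m
        using power_increasing[OF that, of "2::real"] by linarith
      then show ?thesis by (auto simp: eventually_sequentially)
    qed
    ultimately have "\<forall>\<^sub>F m in sequentially. \<omega> \<in> U m"
    proof eventually_elim
      case (elim m)
      have "real (j m) \<le> s * 2 ^ m" by (rule j)
      also have "\<dots> \<le> 2 ^ m * 2 ^ m" using elim by simp
      also have "\<dots> = real (4 ^ m)" by (simp add: power_mult_distrib[symmetric])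
      finally have "j m \<le> 4 ^ m" by (simp only: of_nat_le_iff)
      then show ?case unfolding U_def using elim \<omega> by auto
    qed
    then show "\<omega> \<in> (\<Union>m. U m)" by (auto simp: eventually_sequentially)
  qed
  then have eq: "?U = (\<Union>m. U m)" using U_sub by blast
  show "?U \<in> sets (future t)" unfolding eq using U_future by auto
  have "incseq U"
  proof (rule incseq_SucI, rule subsetI)
    fix m \<omega> assume "\<omega> \<in> U m"
    then obtain j where j: "\<omega> \<in> space M" "j \<le> 4 ^ m" "incr t (t + real j * h m) \<omega> + c * (real j * h m) < - a"
      by (auto simp: U_def)
    have eq: "real (2 * j) * h (Suc m) = real j * h m" by (simp add: h_def)
    show "\<omega> \<in> U (Suc m)"
      unfolding U_def
    proof (intro CollectI conjI exI[of _ "2 * j"])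
      show "incr t (t + real (2 * j) * h (Suc m)) \<omega> + c * (real (2 * j) * h (Suc m)) < - a"
        unfolding eq by (rule j)
    qed (use j in auto)
  qed
  then have "(\<lambda>m. prob (U m)) \<longlonglongrightarrow> prob ?U"
    unfolding eq using U_future future_events[OF t] by (intro finite_Lim_measure_incseq) auto
  moreover have "prob (U m) \<le> exp (- 2 * c * a)" for m
    unfolding U_def by (rule grid_maximal_inequality[OF t c a]) (simp add: h_def)
  ultimately show "prob ?U \<le> exp (- 2 * c * a)"
    by (intro LIMSEQ_le_const2[where X="\<lambda>m. prob (U m)"]) auto
qed

text \<open>Brownian scaling: in units of \<open>sqrt h\<close> the increment has a law independent
  of \<open>h\<close>, so \<open>h\<close> can be made small without losing probability.\<close>

lemma prob_increment_tail:
  assumes "0 \<le> t" "0 < h"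
  shows "prob {\<omega> \<in> space M. sqrt h \<le> incr t (t + h) \<omega>} = measure (density lborel std_normal_density) {1..}"
proof -
  let ?Y = "\<lambda>\<omega>. (incr t (t + h) \<omega> - 0) / sqrt h"
  have "distributed M lborel (incr t (t + h)) (normal_density 0 (sqrt h))"
    using increment_normal[of t "t + h"] assms by (simp add: incr_def[abs_def])
  then have Y: "distributed M lborel ?Y std_normal_density"
    using assms by (subst (asm) normal_standard_normal_convert) auto
  have "{\<omega> \<in> space M. sqrt h \<le> incr t (t + h) \<omega>} = ?Y -` {1..} \<inter> space M"
    using assms by (auto simp: pos_le_divide_eq)
  moreover have "prob (?Y -` {1..} \<inter> space M) = measure (distr M lborel ?Y) {1..}"
    using Y by (intro measure_distr[symmetric]) (auto simp: distributed_def)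
  ultimately show ?thesis using distributed_distr_eq_density[OF Y] by simp
qed

section \<open>Climbs, staircases and escape\<close>

definition climb :: "real \<Rightarrow> real \<Rightarrow> real \<Rightarrow> 'a set" where
  "climb e t h = {\<omega> \<in> space M. (\<forall>s\<in>{0..h}. - e < incr t (t + s) \<omega>) \<and> sqrt h \<le> incr t (t + h) \<omega>}"

text \<open>The sigma-algebra is left open because \<open>staircase\<close> needs a climb both in
  the future of its start, for independence, and in the past of its end, to append the next
  one.\<close>

lemma climb_sets:
  assumes "0 \<le> t" "0 \<le> h" "space N = space M"
    and meas: "\<And>s. 0 \<le> s \<Longrightarrow> s \<le> h \<Longrightarrow> incr t (t + s) \<in> borel_measurable N"
  shows "climb e t h \<in> sets N"
proof -
  have "{\<omega> \<in> space N. hits (\<lambda>s. incr t (t + s) \<omega>) (\<lambda>_. - e) h} \<in> sets N"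
    using assms incr_continuous by (intro hits_measurable barrier_const) auto
  moreover have "{\<omega> \<in> space N. sqrt h \<le> incr t (t + h) \<omega>} \<in> sets N"
    using meas[of h] assms by measurable
  moreover have "climb e t h = {\<omega> \<in> space N. sqrt h \<le> incr t (t + h) \<omega>} -
      {\<omega> \<in> space N. hits (\<lambda>s. incr t (t + s) \<omega>) (\<lambda>_. - e) h}"
    using assms by (auto simp: climb_def hits_def not_le)
  ultimately show ?thesis by auto
qed

text \<open>A rise of \<open>sqrt h\<close> has a probability \<open>q\<close> that does not depend
  on \<open>h\<close>, and for large \<open>c\<close> a drifted dip below \<open>- (e / 2)\<close>
  is less likely than \<open>q\<close>. For small \<open>h\<close> the drift is negligible on
  \<open>{0..h}\<close>, so a rise without such a dip is a climb. The bound \<open>h0\<close> is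
  uniform in \<open>t\<close>, as the staircase requires.\<close>

lemma prob_climb_pos:
  assumes "0 < e"
  shows "\<exists>h0>0. \<forall>t\<ge>0. \<forall>h. 0 < h \<and> h \<le> h0 \<longrightarrow> 0 < prob (climb e t h)"
proof -
  define q where "q = measure (density lborel std_normal_density) {1..}"
  have q: "0 < q" unfolding q_def by (rule std_normal_tail_pos)
  \<comment> \<open>Then \<open>c * e\<close> exceeds \<open>- ln q\<close>, which puts the dip
    bound \<open>exp (- c * e)\<close> below \<open>q\<close>.\<close>
  define c where "c = (1 + \<bar>ln q\<bar>) / e"
  have c: "0 < c" using assms by (simp add: c_def add_pos_nonneg)
  have "exp (- c * e) < exp (ln q)" using assms by (simp add: c_def)
  then have cq: "exp (- 2 * c * (e / 2)) < q" using q by simp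
  have "0 < prob (climb e t h)" if t: "0 \<le> t" and h: "0 < h" "h \<le> e / (4 * c)" for t h
  proof -
    let ?T = "{\<omega> \<in> space M. sqrt h \<le> incr t (t + h) \<omega>}"
    let ?U = "{\<omega> \<in> space M. \<exists>s\<ge>0. incr t (t + s) \<omega> + c * s < - (e / 2)}"
    have U: "?U \<in> events" using dip_future[of t c "e / 2"] future_events[OF t] t c assms by auto
    have K: "climb e t h \<in> events" using t h by (intro climb_sets) (auto intro!: incr_measurable)
    have "?T \<subseteq> climb e t h \<union> ?U"
    proof
      fix \<omega> assume "\<omega> \<in> ?T"
      then have \<omega>: "\<omega> \<in> space M" "sqrt h \<le> incr t (t + h) \<omega>" by auto
      show "\<omega> \<in> climb e t h \<union> ?U"
      proof (cases "\<forall>s\<in>{0..h}. - e < incr t (t + s) \<omega>")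
        case False
        then obtain s where s: "0 \<le> s" "s \<le> h" "incr t (t + s) \<omega> \<le> - e" by (auto simp: not_less)
        \<comment> \<open>The drift adds at most \<open>e / 4\<close>, so a path at or below
          \<open>- e\<close> remains below \<open>- (e / 2)\<close> with it.\<close>
        have "c * s \<le> c * (e / (4 * c))" using c s h by (intro mult_left_mono) auto
        also have "\<dots> < e / 2" using c assms by simp
        finally have "incr t (t + s) \<omega> + c * s < - (e / 2)" using s by simp
        then show ?thesis using \<omega> s by blast
      qed (use \<omega> in \<open>auto simp: climb_def\<close>)
    qed
    then have "prob ?T \<le> prob (climb e t h \<union> ?U)" using K U by (intro finite_measure_mono) auto
    also have "\<dots> \<le> prob (climb e t h) + prob ?U" using K U by (rule measure_Un_le)
    finally have "q \<le> prob (climb e t h) + prob ?U"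
      using prob_increment_tail[OF t h(1)] by (simp add: q_def)
    moreover have "prob ?U \<le> exp (- 2 * c * (e / 2))" using t c assms by (intro prob_dip) auto
    ultimately show ?thesis using cq by linarith
  qed
  then show ?thesis using c assms by (intro exI[of _ "e / (4 * c)"]) auto
qed

text \<open>
  Brownian motion started from a past event of positive probability follows, with positive
  probability, a staircase of \<open>n\<close> short climbs, each of height at least the square root of its
  duration; the total height \<open>n sqrt h\<close> exceeds any level for a fixed total duration \<open>n h\<close>.
\<close>

lemma staircase:
  assumes e: "0 < e" and h0: "\<And>t. 0 \<le> t \<Longrightarrow> 0 < prob (climb e t h)" and h: "0 < h"
    and t: "0 \<le> t" and E: "E \<in> sets (past t)" "0 < prob E"
  shows "\<exists>E'\<in>sets (past (t + real n * h)). E' \<subseteq> E \<and> 0 < prob E' \<and>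
    (\<forall>\<omega>\<in>E'. (\<forall>s\<in>{0..real n * h}. - e < incr t (t + s) \<omega>) \<and> real n * sqrt h \<le> incr t (t + real n * h) \<omega>)"
proof (induction n)
  case 0
  then show ?case using E e by (intro bexI[of _ E]) auto
next
  case (Suc n)
  define r where "r = t + real n * h"
  have r: "0 \<le> r" "t + real (Suc n) * h = r + h" using t h by (auto simp: r_def algebra_simps)
  obtain E' where E': "E' \<in> sets (past r)" "E' \<subseteq> E" "0 < prob E'"
    and low: "\<And>\<omega> s. \<omega> \<in> E' \<Longrightarrow> s \<in> {0..real n * h} \<Longrightarrow> - e < incr t (t + s) \<omega>"
    and high: "\<And>\<omega>. \<omega> \<in> E' \<Longrightarrow> real n * sqrt h \<le> incr t r \<omega>"
    using Suc.IH unfolding r_def by blast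
  show ?case
  proof (intro bexI[of _ "E' \<inter> climb e r h"] conjI ballI)
    have "prob (E' \<inter> climb e r h) = prob E' * prob (climb e r h)"
      using r(1) h E'(1) by (intro prob_past_future climb_sets) (auto intro!: incr_future)
    then show "0 < prob (E' \<inter> climb e r h)" using E' h0[OF r(1)] by simp
    have "E' \<in> sets (past (r + h))" using particle_filtration_mono[THEN subsetD, OF _ E'(1)] h by simp
    moreover have "climb e r h \<in> sets (past (r + h))"
      using r(1) h by (intro climb_sets) (auto intro!: incr_past)
    ultimately show "E' \<inter> climb e r h \<in> sets (past (t + real (Suc n) * h))" unfolding r(2) by auto
    show "E' \<inter> climb e r h \<subseteq> E" using E' by auto
    fix \<omega> assume \<omega>: "\<omega> \<in> E' \<inter> climb e r h"
    \<comment> \<open>Each climb starts at or above the initial level, so a dip of less than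
      \<open>e\<close> below its start stays above \<open>- e\<close>.\<close>
    have pos: "0 \<le> incr t r \<omega>" using high[of \<omega>] \<omega> h by (auto intro: order_trans[rotated])
    show "- e < incr t (t + s) \<omega>" if s: "s \<in> {0..real (Suc n) * h}" for s
    proof (cases "s \<le> real n * h")
      case False
      then have "s - real n * h \<in> {0..h}" using s by (auto simp: algebra_simps)
      then have "- e < incr r (r + (s - real n * h)) \<omega>" using \<omega> by (auto simp: climb_def)
      then have "- e < incr r (t + s) \<omega>" by (simp add: r_def)
      then show ?thesis using pos incr_add[of t r \<omega> "t + s"] by linarith
    qed (use low \<omega> s in auto)
    have "sqrt h \<le> incr r (r + h) \<omega>" using \<omega> by (auto simp: climb_def)
    then have "real n * sqrt h + sqrt h \<le> incr t (r + h) \<omega>"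
      using high[of \<omega>] \<omega> incr_add[of t r \<omega> "r + h"] by auto
    then show "real (Suc n) * sqrt h \<le> incr t (t + real (Suc n) * h) \<omega>"
      unfolding r(2) by (simp add: algebra_simps)
  qed
qed

text \<open>A staircase reaches level \<open>K + 1\<close> within the prescribed time
  \<open>d\<close>, however short. From there on the drift \<open>b\<close> keeps the path from
  losing more than \<open>1\<close>, with positive probability and independently of the
  past.\<close>

lemma escape:
  assumes t: "0 \<le> t" and E: "E \<in> sets (past t)" "0 < prob E"
    and e: "0 < e" and d: "0 < d" and b: "0 < b"
  shows "\<exists>E'\<in>events. E' \<subseteq> E \<and> 0 < prob E' \<and>
    (\<forall>\<omega>\<in>E'. (\<forall>s\<in>{0..d}. - e < incr t (t + s) \<omega>) \<and> (\<forall>s\<ge>d. K \<le> incr t (t + s) \<omega> + b * s))"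
proof -
  obtain h0 where h0: "0 < h0" "\<And>t h. 0 \<le> t \<Longrightarrow> 0 < h \<Longrightarrow> h \<le> h0 \<Longrightarrow> 0 < prob (climb e t h)"
    using prob_climb_pos[OF e] by blast
  \<comment> \<open>\<open>n > d / h0\<close> makes the climbs of length \<open>d / n\<close> short
    enough, and \<open>n > (K + 1)\<^sup>2 / d\<close> makes their total height
    \<open>sqrt (n * d)\<close> at least \<open>K + 1\<close>.\<close>
  obtain n :: nat where n: "max 1 (max (d / h0) ((K + 1)\<^sup>2 / d)) < real n" using reals_Archimedean2 by blast
  define h where "h = d / real n"
  have n0: "0 < real n" using n by linarith
  have h: "0 < h" "h \<le> h0" "real n * h = d"
    using n n0 d h0(1) by (auto simp: h_def pos_divide_le_eq pos_divide_less_eq mult.commute less_imp_le)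
  have "(K + 1)\<^sup>2 \<le> real n * d" using n d by (simp add: divide_less_eq)
  then have "K + 1 \<le> sqrt (real n * d)" by (rule real_le_rsqrt)
  also have "real n * d = (real n)\<^sup>2 * h" using n0 by (simp add: h_def power2_eq_square)
  also have "sqrt \<dots> = real n * sqrt h" by (simp add: real_sqrt_mult)
  finally have K: "K + 1 \<le> real n * sqrt h" .
  obtain E' where E': "E' \<in> sets (past (t + d))" "E' \<subseteq> E" "0 < prob E'"
    and low: "\<And>\<omega> s. \<omega> \<in> E' \<Longrightarrow> s \<in> {0..d} \<Longrightarrow> - e < incr t (t + s) \<omega>"
    and high: "\<And>\<omega>. \<omega> \<in> E' \<Longrightarrow> real n * sqrt h \<le> incr t (t + d) \<omega>"
    using staircase[OF e h0(2)[OF _ h(1,2)] h(1) t E, of n] unfolding h(3) by blast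
  define r where "r = t + d"
  have r: "0 \<le> r" using t d by (simp add: r_def)
  let ?U = "{\<omega> \<in> space M. \<exists>s\<ge>0. incr r (r + s) \<omega> + b * s < - 1}"
  have U: "?U \<in> sets (future r)" using r b by (intro dip_future) auto
  have "prob ?U \<le> exp (- 2 * b * 1)" using r b by (intro prob_dip) auto
  also have "\<dots> < 1" using b by simp
  finally have "0 < prob (space M - ?U)"
    using U future_events[OF r] by (subst prob_compl) auto
  moreover have "space M - ?U \<in> sets (future r)" using sets.compl_sets[OF U] by simp
  ultimately have "0 < prob (E' \<inter> (space M - ?U))"
    using prob_past_future[OF r, of E' "space M - ?U"] E' by (simp add: r_def)
  moreover have "E' \<inter> (space M - ?U) \<in> events"
    using past_events[THEN subsetD, OF E'(1)] future_events[OF r, THEN subsetD, OF U] by auto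
  moreover have "K \<le> incr t (t + s) \<omega> + b * s" if \<omega>: "\<omega> \<in> E' \<inter> (space M - ?U)" and "d \<le> s" for \<omega> s
  proof -
    have "- 1 \<le> incr r (r + (s - d)) \<omega> + b * (s - d)" using that by (auto simp: not_less)
    then have "- 1 \<le> incr r (t + s) \<omega> + b * (s - d)" by (simp add: r_def)
    moreover have "0 \<le> b * d" using b d by simp
    moreover have "K + 1 \<le> incr t r \<omega>" using high[of \<omega>] \<omega> K by (auto simp: r_def)
    ultimately show ?thesis
      using incr_add[of t r \<omega> "t + s"] by (simp add: algebra_simps)
  qed
  ultimately show ?thesis using low E'(2) by (intro bexI[of _ "E' \<inter> (space M - ?U)"]) auto
qed

end

subsection \<open>The McKean--Vlasov equation\<close>

text \<open>An \<open>l\<close> that is nearly minimal at \<open>t\<close> also bounds the infimum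
  shortly after \<open>t\<close>, by its own right-continuity.\<close>

lemma MM_Inf:
  assumes S: "S \<subseteq> MM" "S \<noteq> {}"
  shows "(\<lambda>t. if t < 0 then 0 else INF l\<in>S. l t) \<in> MM"
proof (rule MM_intro)
  have bdd: "bdd_below ((\<lambda>l. l t) ` S)" if "0 \<le> t" for t
    using MM_nonneg[OF _ that] S by (intro bdd_belowI2[where m=0]) auto
  have le: "(INF l\<in>S. l t) \<le> l t" if "0 \<le> t" "l \<in> S" for l t
    using that by (intro cINF_lower bdd)
  show mono: "mono_on {-1..} (\<lambda>t. if t < 0 then 0 else INF l\<in>S. l t)"
  proof (rule mono_onI)
    fix s t :: real assume st: "s \<in> {-1..}" "t \<in> {-1..}" "s \<le> t"
    have "0 \<le> (INF l\<in>S. l t)" if "0 \<le> t"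
      using S MM_nonneg[OF _ that] by (intro cINF_greatest) auto
    moreover have "(INF l\<in>S. l s) \<le> (INF l\<in>S. l t)" if "0 \<le> s"
    proof (intro cINF_mono S bdd that)
      fix l assume "l \<in> S"
      then have "l s \<le> l t" using st S by (intro mono_onD[OF MM_mono[of l]]) auto
      then show "\<exists>l'\<in>S. l' s \<le> l t" using \<open>l \<in> S\<close> by auto
    qed
    ultimately show "(if s < 0 then 0 else INF l\<in>S. l s) \<le> (if t < 0 then 0 else INF l\<in>S. l t)"
      using st by auto
  qed
  fix t :: real assume t: "0 \<le> t"
  obtain l0 where "l0 \<in> S" using S by auto
  then show "(if t < 0 then 0 else INF l\<in>S. l t) \<le> 1"
    using le[OF t, of l0] MM_le_one[OF _ t, of l0] S t by force
  show "((\<lambda>t. if t < 0 then 0 else INF l\<in>S. l t) \<longlongrightarrow> (if t < 0 then 0 else INF l\<in>S. l t)) (at_right t)"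
  proof (rule mono_tendsto_at_right[OF mono])
    fix e :: real assume "0 < e"
    then have "(INF l\<in>S. l t) < (INF l\<in>S. l t) + e" by simp
    then obtain l where l: "l \<in> S" "l t < (INF l\<in>S. l t) + e"
      using S bdd[OF t] by (subst (asm) cINF_less_iff) auto
    have "\<forall>\<^sub>F s in at_right t. l s < (INF l\<in>S. l t) + e"
      using l S t by (intro order_tendstoD(2)[OF MM_at_right]) auto
    then obtain b where b: "t < b" "\<And>s. t < s \<Longrightarrow> s < b \<Longrightarrow> l s < (INF l\<in>S. l t) + e"
      by (auto simp: eventually_at_right_field)
    obtain s where s: "t < s" "s < b" using dense b by blast
    then have "(INF l\<in>S. l s) < (INF l\<in>S. l t) + e" using b(2)[of s] le[of s l] l t by auto
    then show "\<exists>s>t. (if s < 0 then 0 else INF l\<in>S. l s) < (if t < 0 then 0 else INF l\<in>S. l t) + e"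
      using s t by (intro exI[of _ s]) auto
  qed (use t in auto)
qed auto

locale mckean_vlasov = feedback G + driver M Z B
  for G :: "real \<Rightarrow> real" and M :: "'a measure" and Z :: "'a \<Rightarrow> real" and B :: "real \<Rightarrow> 'a \<Rightarrow> real" +
  fixes \<beta> :: real
begin

definition free :: "'a \<Rightarrow> real \<Rightarrow> real" where
  "free \<omega> t = Z \<omega> + \<beta> * t + B t \<omega>"

lemma free_continuous: "\<omega> \<in> space M \<Longrightarrow> continuous_on {0..} (free \<omega>)"
  unfolding free_def by (intro continuous_intros B_continuous)

lemma free_measurable: "0 \<le> t \<Longrightarrow> (\<lambda>\<omega>. free \<omega> t) \<in> borel_measurable M"
  unfolding free_def using B_measurable[of t] by measurable

definition hit_event :: "(real \<Rightarrow> real) \<Rightarrow> real \<Rightarrow> 'a set" where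
  "hit_event l t = {\<omega> \<in> space M. hits (free \<omega>) (\<lambda>s. G (l s)) t}"

definition hit_prob :: "(real \<Rightarrow> real) \<Rightarrow> real \<Rightarrow> real" where
  "hit_prob l t = prob (hit_event l t)"

lemma hit_event_sets:
  assumes "l \<in> MM" shows "hit_event l t \<in> events"
  unfolding hit_event_def
  using barrier_MM[OF assms] free_continuous free_measurable by (intro hits_measurable) auto

lemma hit_event_mono_time: "s \<le> t \<Longrightarrow> hit_event l s \<subseteq> hit_event l t"
  unfolding hit_event_def using hits_mono_time by auto

lemma hit_event_mono:
  assumes "l \<in> MM" "l' \<in> MM" "\<And>s. 0 \<le> s \<Longrightarrow> l s \<le> l' s"
  shows "hit_event l t \<subseteq> hit_event l' t"
proof -
  have "G (l s) \<le> G (l' s)" if "s \<in> {0..t}" for s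
    using that MM_nonneg[OF assms(1)] MM_le_one[OF assms(2)] assms(3) by (intro G_comp_mono) auto
  then show ?thesis
    unfolding hit_event_def using hits_mono[of _ "\<lambda>s. G (l s)" t "\<lambda>s. G (l' s)"] by auto
qed

lemma hit_prob_mono:
  assumes "l \<in> MM" "l' \<in> MM" "\<And>s. 0 \<le> s \<Longrightarrow> l s \<le> l' s"
  shows "hit_prob l t \<le> hit_prob l' t"
  unfolding hit_prob_def by (intro finite_measure_mono hit_event_mono hit_event_sets assms)

text \<open>Right-continuity is continuity of the measure from above: by \<open>hits_later\<close>
  the events at times decreasing to \<open>t\<close> intersect in the event at
  \<open>t\<close>.\<close>

lemma hit_prob_MM:
  assumes l: "l \<in> MM" shows "hit_prob l \<in> MM"
proof (rule MM_intro)
  show "mono_on {-1..} (hit_prob l)"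
    unfolding hit_prob_def
    by (intro mono_onI finite_measure_mono hit_event_mono_time hit_event_sets l) auto
  show "hit_prob l t = 0" if "t \<in> {-1..<0}" for t
  proof -
    have "hit_event l t = {}" using that by (auto simp: hit_event_def not_hits_neg)
    then show ?thesis by (simp add: hit_prob_def)
  qed
  show "hit_prob l t \<le> 1" for t by (simp add: hit_prob_def)
  fix t :: real assume "0 \<le> t"
  show "(hit_prob l \<longlongrightarrow> hit_prob l t) (at_right t)"
  proof (rule tendsto_at_right_sequentially[of t "t + 1"])
    fix S assume S: "\<And>n. t < S n" "decseq S" "S \<longlonglongrightarrow> t"
    have "(\<Inter>n. hit_event l (S n)) \<subseteq> hit_event l t"
      using barrier.hits_later[OF barrier_MM[OF l] free_continuous _ S(3)] by (auto simp: hit_event_def)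
    moreover have "hit_event l t \<subseteq> (\<Inter>n. hit_event l (S n))"
      using S(1) by (intro INT_greatest hit_event_mono_time) (simp add: less_imp_le)
    ultimately have "(\<Inter>n. hit_event l (S n)) = hit_event l t" by (rule antisym)
    moreover have "(\<lambda>n. prob (hit_event l (S n))) \<longlonglongrightarrow> prob (\<Inter>n. hit_event l (S n))"
    proof (rule finite_Lim_measure_decseq)
      show "decseq (\<lambda>n. hit_event l (S n))"
        unfolding decseq_def by (intro allI impI hit_event_mono_time decseqD[OF S(2)])
    qed (use hit_event_sets[OF l] in auto)
    ultimately show "(\<lambda>n. hit_prob l (S n)) \<longlonglongrightarrow> hit_prob l t" by (simp add: hit_prob_def)
  qed simp
qed

text \<open>The loss determines \<open>X\<close> at nonnegative times, so solving the equation is a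
  fixed point problem for deterministic loss paths.\<close>

lemma MV_solution_iff:
  "MV_solution M G \<beta> Z B X l \<longleftrightarrow> l \<in> MM \<and>
     (\<forall>\<omega>\<in>space M. \<forall>t\<ge>0. X t \<omega> = free \<omega> t - G (l t)) \<and> (\<forall>t\<ge>0. l t = hit_prob l t)"
proof -
  have "{\<omega>\<in>space M. hitting_time (\<lambda>s. X s \<omega>) \<le> ereal t} = hit_event l t"
    if "l \<in> MM" "\<forall>\<omega>\<in>space M. \<forall>t\<ge>0. X t \<omega> = free \<omega> t - G (l t)" for t
  proof -
    have "hitting_time (\<lambda>s. X s \<omega>) = hitting_time (\<lambda>s. free \<omega> s - G (l s))" if "\<omega> \<in> space M" for \<omega>
      by (rule hitting_time_cong) (use that \<open>\<forall>\<omega>\<in>space M. _ \<omega>\<close> in auto)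
    then show ?thesis
      using barrier.hitting_time_le_iff[OF barrier_MM[OF that(1)] free_continuous]
      by (auto simp: hit_event_def)
  qed
  then show ?thesis unfolding MV_solution_def hit_prob_def free_def by auto
qed

section \<open>The least fixed point\<close>

definition supersolutions :: "(real \<Rightarrow> real) set" where
  "supersolutions = {l \<in> MM. \<forall>t\<ge>0. hit_prob l t \<le> l t}"

definition least :: "real \<Rightarrow> real" where
  "least t = (if t < 0 then 0 else INF l\<in>supersolutions. l t)"

lemma supersolutions_nonempty: "supersolutions \<noteq> {}"
proof -
  have "(\<lambda>t. if t < 0 then 0 else 1) \<in> MM"
    by (rule MM_intro) (auto intro!: mono_onI tendsto_eventually
        simp: eventually_at_right_field intro: gt_ex)
  then have "(\<lambda>t. if t < 0 then 0 else 1) \<in> supersolutions"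
    by (auto simp: supersolutions_def hit_prob_def)
  then show ?thesis by auto
qed

lemma least_MM: "least \<in> MM"
  unfolding least_def[abs_def]
  by (intro MM_Inf supersolutions_nonempty) (auto simp: supersolutions_def)

lemma least_le:
  assumes "l \<in> supersolutions" "0 \<le> t" shows "least t \<le> l t"
  using assms MM_nonneg
  by (auto simp: least_def supersolutions_def intro!: cINF_lower bdd_belowI2[where m=0])

text \<open>Knaster-Tarski: by monotonicity the infimum is itself a supersolution; so is its image,
  which therefore cannot lie strictly below it.\<close>

lemma least_fixpoint:
  assumes "0 \<le> t" shows "least t = hit_prob least t"
proof -
  have super: "hit_prob least t \<le> least t" if "0 \<le> t" for t
  proof -
    have "hit_prob least t \<le> l t" if l: "l \<in> supersolutions" for l
    proof -
      have "hit_prob least t \<le> hit_prob l t"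
        using l least_le by (intro hit_prob_mono least_MM) (auto simp: supersolutions_def)
      also have "\<dots> \<le> l t" using l \<open>0 \<le> t\<close> by (auto simp: supersolutions_def)
      finally show ?thesis .
    qed
    then show ?thesis
      using that supersolutions_nonempty by (auto simp: least_def intro!: cINF_greatest)
  qed
  then have "hit_prob least \<in> supersolutions"
    unfolding supersolutions_def
    by (auto intro!: hit_prob_MM least_MM hit_prob_mono super)
  from least_le[OF this assms] super[OF assms] show ?thesis by simp
qed

lemma MV_minimal_least:
  "MV_minimal_solution M G \<beta> Z B (\<lambda>t \<omega>. free \<omega> t - G (least t)) least"
  unfolding MV_minimal_solution_def
proof (intro conjI allI impI)
  show "MV_solution M G \<beta> Z B (\<lambda>t \<omega>. free \<omega> t - G (least t)) least"
    unfolding MV_solution_iff using least_MM least_fixpoint by auto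
  fix X' l' t assume "MV_solution M G \<beta> Z B X' l'" "0 \<le> (t::real)"
  then show "least t \<le> l' t"
    by (intro least_le) (auto simp: MV_solution_iff supersolutions_def)
qed

section \<open>Separation of the limits under positive drift\<close>

lemma least_strict_limit:
  assumes \<beta>: "0 < \<beta>" and l: "l \<in> MM" and fixpt: "\<And>t. 0 \<le> t \<Longrightarrow> l t = hit_prob l t"
    and t: "0 \<le> t" and ne: "l t \<noteq> least t"
  shows "lim_infty least < lim_infty l"
proof -
  have "l \<in> supersolutions" using l fixpt by (simp add: supersolutions_def)
  then have le: "least s \<le> l s" if "0 \<le> s" for s using that by (rule least_le)
  then have sub: "hit_event least s \<subseteq> hit_event l s" for s by (intro hit_event_mono least_MM l)
  have diff: "prob (hit_event l s - hit_event least s) = l s - least s" if "0 \<le> s" for s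
    using finite_measure_Diff[OF hit_event_sets[OF l] hit_event_sets[OF least_MM] sub, of s]
      fixpt[OF that] least_fixpoint[OF that] by (simp add: hit_prob_def)
  \<comment> \<open>A particle not absorbed by time \<open>t\<close> sits strictly above the
    barrier, but by no uniform amount; cutting at \<open>1 / (k + 1)\<close> secures a fixed margin
    with positive probability while staying in the past of \<open>t\<close>.\<close>
  define E where "E k = (hit_event l t - hit_event least t) \<inter>
    {\<omega> \<in> space M. inverse (real (Suc k)) < free \<omega> t - G (least t)}" for k
  have free_past: "(\<lambda>\<omega>. free \<omega> s) \<in> borel_measurable (past t)" if "s \<in> {0..t}" for s
  proof -
    have [measurable]: "Z \<in> borel_measurable (past t)" "B s \<in> borel_measurable (past t)"
      using that initial_measurable_filtration[of 1 "Suc 0" "\<lambda>_. Z"]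
        process_measurable_filtration[of 1 "Suc 0" s t "\<lambda>_. B"] by auto
    show ?thesis unfolding free_def by measurable
  qed
  have hit_past: "hit_event l' t \<in> sets (past t)" if "l' \<in> MM" for l'
  proof -
    have "{\<omega> \<in> space (past t). hits (free \<omega>) (\<lambda>s. G (l' s)) t} \<in> sets (past t)"
      using barrier_MM[OF that] free_continuous free_past by (intro hits_measurable) auto
    then show ?thesis by (simp add: hit_event_def)
  qed
  have E_past: "E k \<in> sets (past t)" for k
  proof -
    have [measurable]: "(\<lambda>\<omega>. free \<omega> t) \<in> borel_measurable (past t)" using t by (intro free_past) auto
    have "{\<omega> \<in> space (past t). inverse (real (Suc k)) < free \<omega> t - G (least t)} \<in> sets (past t)"
      by measurable
    then show ?thesis unfolding E_def using hit_past[OF l] hit_past[OF least_MM] by auto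
  qed
  have "incseq E"
  proof (rule incseq_SucI)
    fix k
    have "inverse (real (Suc (Suc k))) \<le> inverse (real (Suc k))" by (intro le_imp_inverse_le) auto
    then show "E k \<subseteq> E (Suc k)" unfolding E_def by (blast intro: le_less_trans)
  qed
  moreover have "(\<Union>k. E k) = hit_event l t - hit_event least t"
  proof -
    have "\<exists>k. \<omega> \<in> E k" if \<omega>: "\<omega> \<in> hit_event l t - hit_event least t" for \<omega>
    proof -
      have "\<omega> \<in> space M" "\<not> hits (free \<omega>) (\<lambda>s. G (least s)) t" using \<omega> by (auto simp: hit_event_def)
      then have "0 < free \<omega> t - G (least t)" using t by (auto simp: hits_def not_le)
      from reals_Archimedean[OF this] show ?thesis using \<omega> \<open>\<omega> \<in> space M\<close> by (auto simp: E_def)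
    qed
    then show ?thesis by (auto simp: E_def)
  qed
  ultimately have "(\<lambda>k. prob (E k)) \<longlonglongrightarrow> prob (hit_event l t - hit_event least t)"
    using finite_Lim_measure_incseq[of E] image_subsetI[of UNIV E events, OF past_events[THEN subsetD, OF E_past]]
    by simp
  moreover have "0 < prob (hit_event l t - hit_event least t)"
    unfolding diff[OF t] using le[OF t] ne by simp
  ultimately have "\<forall>\<^sub>F k in sequentially. 0 < prob (E k)" by (rule order_tendstoD)
  then obtain k where k: "0 < prob (E k)" by (auto simp: eventually_sequentially)
  \<comment> \<open>Half of the margin pays for the rise of the barrier up to \<open>t + d\<close>,
    the other half for the dip of the Brownian motion.\<close>
  define e where "e = inverse (real (Suc k)) / 2"
  have e: "0 < e" by (simp add: e_def)
  have "((\<lambda>s. G (least s)) \<longlongrightarrow> G (least t)) (at_right t)"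
    using barrier.at_right[OF barrier_MM[OF least_MM] t] .
  then have "\<forall>\<^sub>F s in at_right t. G (least s) < G (least t) + e"
    by (rule order_tendstoD) (use e in simp)
  then obtain b where b: "t < b" "\<And>s. t < s \<Longrightarrow> s < b \<Longrightarrow> G (least s) < G (least t) + e"
    by (auto simp: eventually_at_right_field)
  \<comment> \<open>Halving keeps \<open>t + d\<close> strictly inside the window, so the estimate
    also holds at that endpoint.\<close>
  define d where "d = (b - t) / 2"
  have d: "0 < d" "t + d < b" using b by (auto simp: d_def field_simps)
  \<comment> \<open>The barrier never exceeds \<open>G 1\<close>, so a path above
    \<open>G (least t)\<close> at time \<open>t\<close> that gains \<open>G 1 - G (least t)\<close>
    is clear of it.\<close>
  obtain E' where E': "E' \<in> events" "E' \<subseteq> E k" "0 < prob E'"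
    and near: "\<And>\<omega> s. \<omega> \<in> E' \<Longrightarrow> s \<in> {0..d} \<Longrightarrow> - e < incr t (t + s) \<omega>"
    and far: "\<And>\<omega> s. \<omega> \<in> E' \<Longrightarrow> d \<le> s \<Longrightarrow> G 1 - G (least t) \<le> incr t (t + s) \<omega> + \<beta> * s"
    using escape[OF t E_past k e d(1) \<beta>, of "G 1 - G (least t)"] by blast
  have never: "G (least u) < free \<omega> u" if \<omega>: "\<omega> \<in> E'" and u: "0 \<le> u" for \<omega> u
  proof (cases "u \<le> t")
    case True
    have "\<not> hits (free \<omega>) (\<lambda>s. G (least s)) t" using \<omega> E' by (auto simp: E_def hit_event_def)
    then show ?thesis using True u by (auto simp: hits_def not_le)
  next
    case False
    have "2 * e < free \<omega> t - G (least t)" using \<omega> E' by (auto simp: E_def e_def)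
    moreover have "free \<omega> u = free \<omega> t + \<beta> * (u - t) + incr t (t + (u - t)) \<omega>"
      by (simp add: free_def incr_def algebra_simps)
    moreover have "0 \<le> \<beta> * (u - t)" using \<beta> False by simp
    moreover have "G (least u) < G (least t) + e \<and> - e < incr t (t + (u - t)) \<omega>" if "u - t \<le> d"
      using b(2)[of u] near[OF \<omega>, of "u - t"] that d False by auto
    moreover have "G (least u) \<le> incr t (t + (u - t)) \<omega> + \<beta> * (u - t) + G (least t)" if "d \<le> u - t"
    proof -
      have "G (least u) \<le> G 1"
        using MM_nonneg[OF least_MM u] MM_le_one[OF least_MM u] by (intro G_comp_mono) auto
      then show ?thesis using far[OF \<omega> that] by linarith
    qed
    ultimately show ?thesis using e by (cases "u - t \<le> d") auto
  qed
  \<comment> \<open>One event \<open>E'\<close> serves every \<open>s \<ge> t\<close>, so the gap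
    does not shrink in the limit.\<close>
  have "least s + prob E' \<le> l s" if "t \<le> s" for s
  proof -
    have "\<omega> \<in> hit_event l s - hit_event least s" if "\<omega> \<in> E'" for \<omega>
    proof -
      have "\<omega> \<in> hit_event l s"
        using that E' hit_event_mono_time[OF \<open>t \<le> s\<close>] by (auto simp: E_def)
      moreover have "\<not> hits (free \<omega>) (\<lambda>s. G (least s)) s"
        using never[OF that] by (force simp: hits_def)
      ultimately show ?thesis by (auto simp: hit_event_def)
    qed
    then have "prob E' \<le> prob (hit_event l s - hit_event least s)"
      by (intro finite_measure_mono) (auto intro!: hit_event_sets l least_MM)
    then show ?thesis using diff[of s] t that by simp
  qed
  then have "\<forall>\<^sub>F s in at_top. least s + prob E' \<le> l s"
    using eventually_ge_at_top[of t] by (rule eventually_mono[rotated])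
  then have "lim_infty least + prob E' \<le> lim_infty l"
    by (intro tendsto_le[OF _ MM_tendsto_lim_infty[OF l] tendsto_add[OF MM_tendsto_lim_infty[OF least_MM] tendsto_const]]) auto
  then show ?thesis using E'(3) by simp
qed

lemma McKean_Vlasov_minimal_solution:
  "\<exists>X \<Lambda>. MV_minimal_solution M G \<beta> Z B X \<Lambda> \<and>
    (\<forall>X' \<Lambda>'. MV_minimal_solution M G \<beta> Z B X' \<Lambda>' \<longrightarrow>
       (\<forall>t\<ge>0. \<Lambda>' t = \<Lambda> t \<and> (\<forall>\<omega>\<in>space M. X' t \<omega> = X t \<omega>))) \<and>
    (\<beta> > 0 \<longrightarrow>
       (\<forall>X' \<Lambda>'. MV_solution M G \<beta> Z B X' \<Lambda>' \<and>
           (\<exists>t\<ge>0. \<Lambda>' t \<noteq> \<Lambda> t \<or> (\<exists>\<omega>\<in>space M. X' t \<omega> \<noteq> X t \<omega>)) \<longrightarrow>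
          lim_infty \<Lambda> < lim_infty \<Lambda>'))"
proof -
  define X where "X t \<omega> = free \<omega> t - G (least t)" for t \<omega>
  have min: "MV_minimal_solution M G \<beta> Z B X least"
    using MV_minimal_least by (simp add: X_def[abs_def])
  moreover have "\<Lambda>' t = least t \<and> (\<forall>\<omega>\<in>space M. X' t \<omega> = X t \<omega>)"
    if min': "MV_minimal_solution M G \<beta> Z B X' \<Lambda>'" and "0 \<le> t" for X' \<Lambda>' t
  proof -
    have sol: "MV_solution M G \<beta> Z B X' \<Lambda>'" using min' by (simp add: MV_minimal_solution_def)
    have "\<Lambda>' t \<le> least t" "least t \<le> \<Lambda>' t"
      using min min' \<open>0 \<le> t\<close> by (auto simp: MV_minimal_solution_def)
    then have "\<Lambda>' t = least t" by (rule antisym)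
    then show ?thesis using sol \<open>0 \<le> t\<close> by (simp add: MV_solution_iff X_def)
  qed
  moreover have "lim_infty least < lim_infty \<Lambda>'"
    if \<beta>: "\<beta> > 0" and sol: "MV_solution M G \<beta> Z B X' \<Lambda>'"
      and t: "0 \<le> t" "\<Lambda>' t \<noteq> least t \<or> (\<exists>\<omega>\<in>space M. X' t \<omega> \<noteq> X t \<omega>)" for X' \<Lambda>' t
  proof -
    \<comment> \<open>\<open>X'\<close> at time \<open>t\<close> is a function of the loss at
      \<open>t\<close>, so a difference in \<open>X'\<close> forces one in the loss.\<close>
    have "\<Lambda>' t \<noteq> least t" using sol t by (auto simp: MV_solution_iff X_def)
    then show ?thesis using \<beta> sol t(1) by (intro least_strict_limit[of \<Lambda>' t]) (auto simp: MV_solution_iff)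
  qed
  ultimately show ?thesis by (intro exI[of _ X] exI[of _ least]) blast
qed

end

theorem theorem2p2:
  fixes G :: "real \<Rightarrow> real" and \<beta> :: real
  assumes "continuous_on {-1..1} G" and "mono_on {-1..1} G" and "G 0 = 0"
  shows
   "(\<forall>(M::'a measure) N Z B. particle_setting M N Z B \<longrightarrow>
       (\<exists>X L. particle_minimal_solution M N G \<beta> Z B X L \<and>
          (\<forall>X' L'. particle_minimal_solution M N G \<beta> Z B X' L' \<longrightarrow>
             (AE \<omega> in M. \<forall>t\<ge>0. L' t \<omega> = L t \<omega> \<and> (\<forall>i\<in>{1..N}. X' i t \<omega> = X i t \<omega>))))) \<and>
    (\<forall>(M::'b measure) Z B. MV_setting M Z B \<longrightarrow>
       (\<exists>X \<Lambda>. MV_minimal_solution M G \<beta> Z B X \<Lambda> \<and>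
          (\<forall>X' \<Lambda>'. MV_minimal_solution M G \<beta> Z B X' \<Lambda>' \<longrightarrow>
             (\<forall>t\<ge>0. \<Lambda>' t = \<Lambda> t \<and> (\<forall>\<omega>\<in>space M. X' t \<omega> = X t \<omega>))) \<and>
          (\<beta> > 0 \<longrightarrow>
             (\<forall>X' \<Lambda>'. MV_solution M G \<beta> Z B X' \<Lambda>' \<and>
                 (\<exists>t\<ge>0. \<Lambda>' t \<noteq> \<Lambda> t \<or> (\<exists>\<omega>\<in>space M. X' t \<omega> \<noteq> X t \<omega>)) \<longrightarrow>
                lim_infty \<Lambda> < lim_infty \<Lambda>'))))"
proof (intro conjI allI impI)
  interpret feedback G using assms(1,2) by unfold_locales
  show "\<exists>X L. particle_minimal_solution M N G \<beta> Z B X L \<and>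
      (\<forall>X' L'. particle_minimal_solution M N G \<beta> Z B X' L' \<longrightarrow>
        (AE \<omega> in M. \<forall>t\<ge>0. L' t \<omega> = L t \<omega> \<and> (\<forall>i\<in>{1..N}. X' i t \<omega> = X i t \<omega>)))"
    if "particle_setting M N Z B" for M :: "'a measure" and N Z B
    using that by (rule particle_system_minimal_solution)
  fix M :: "'b measure" and Z B assume setting: "MV_setting M Z B"
  interpret prob_space M using setting by (simp add: MV_setting_def)
  interpret mckean_vlasov G M Z B \<beta> using setting by unfold_locales
  show "\<exists>X \<Lambda>. MV_minimal_solution M G \<beta> Z B X \<Lambda> \<and>
    (\<forall>X' \<Lambda>'. MV_minimal_solution M G \<beta> Z B X' \<Lambda>' \<longrightarrow>
       (\<forall>t\<ge>0. \<Lambda>' t = \<Lambda> t \<and> (\<forall>\<omega>\<in>space M. X' t \<omega> = X t \<omega>))) \<and>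
    (\<beta> > 0 \<longrightarrow>
       (\<forall>X' \<Lambda>'. MV_solution M G \<beta> Z B X' \<Lambda>' \<and>
           (\<exists>t\<ge>0. \<Lambda>' t \<noteq> \<Lambda> t \<or> (\<exists>\<omega>\<in>space M. X' t \<omega> \<noteq> X t \<omega>)) \<longrightarrow>
          lim_infty \<Lambda> < lim_infty \<Lambda>'))"
    by (rule McKean_Vlasov_minimal_solution)
qed

end
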